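(* Let $d,a,b,p$ satisfy the admissibility conditions below and $q=p/(p-1)$. Let $u\in\mathcal D^{1,2}_a(\mathbb R^d)$ be nonnegative and not identically zero, set $\kappa=\big(\int_{\mathbb R^d}|u|^p|x|^{-bp}dx\big)^{1/p}$, and let $v$ be defined by $|x|^{-2a}v=\kappa^{2-p}|x|^{-bp}u^{p-1}$; assume $v\in L^q(\mathbb R^d,|x|^{-(2a-b)q}dx)\cap\mathsf L_a(\mathcal D^{1,2}_a(\mathbb R^d))$. Then \[ 0\le\Big(\int_{\mathbb R^d}\frac{|v|^q}{|x|^{(2a-b)q}}dx\Big)^{2/q}-\frac1{\mathsf C_{a,b}}\langle v,\mathsf L_a^{-1}v\rangle\le\mathsf C_{a,b}\int_{\mathbb R^d}\frac{|\nabla u|^2}{|x|^{2a}}dx-\Big(\int_{\mathbb R^d}\frac{|u|^p}{|x|^{bp}}dx\Big)^{2/p}. \]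
   Context: Let $a_c=\frac{d-2}2$, $2^*=\infty$ if $d=1,2$ and $2^*=\frac{2d}{d-2}$ if $d\ge3$. Admissibility: $d\ge1$; $p\in[2,2^*]$ if $d\ge3$, $p\in[2,2^* )$ if $d=1,2$; $b=a-a_c+d/p$; $a<a_c$; and $a\le b\le a+1$ if $d\ge3$, $a<b\le a+1$ if $d=2$, $a+\frac12<b\le a+1$ if $d=1$. $\mathcal D^{1,2}_a(\mathbb R^d)$ is the completion of $C_c^\infty(\mathbb R^d\setminus\{0\})$ w.r.t. $u\mapsto\||x|^{-a}\nabla u\|_2$. $\mathsf C_{a,b}$ is the optimal (finite) constant with $\big(\int\frac{|u|^p}{|x|^{bp}}\big)^{2/p}\le\mathsf C_{a,b}\int\frac{|\nabla u|^2}{|x|^{2a}}$ for all $u\in\mathcal D^{1,2}_a(\mathbb R^d)$. $\langle u,v\rangle=\int u\,v\,|x|^{-2a}dx$; $\mathsf L_a u=-\Delta u+2a\frac{x}{|x|^2}\cdot\nabla u$, with inverse $\mathsf L_a^{-1}$ on $\mathsf L_a(\mathcal D^{1,2}_a(\mathbb R^d))$. *)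

theory Defs
  imports "HOL-Analysis.Analysis"
begin

fun pderiv_list :: "'a::euclidean_space list \<Rightarrow> ('a \<Rightarrow> real) \<Rightarrow> 'a \<Rightarrow> real" where
  "pderiv_list [] f = f"
| "pderiv_list (e # es) f = (\<lambda>x. deriv (\<lambda>t. pderiv_list es f (x + t *\<^sub>R e)) 0)"

definition smooth_on :: "'a::euclidean_space set \<Rightarrow> ('a \<Rightarrow> real) \<Rightarrow> bool" where
  "smooth_on S f \<longleftrightarrow>
     (\<forall>es. set es \<subseteq> Basis \<longrightarrow>
        continuous_on S (pderiv_list es f) \<and>
        (\<forall>e\<in>Basis. \<forall>x\<in>S.
           ((\<lambda>t. pderiv_list es f (x + t *\<^sub>R e)) has_real_derivative pderiv_list (e # es) f x) (at 0)))"

definition grad :: "('a::euclidean_space \<Rightarrow> real) \<Rightarrow> 'a \<Rightarrow> 'a" where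
  "grad f x = (\<Sum>e\<in>Basis. pderiv_list [e] f x *\<^sub>R e)"

definition test_fun :: "('a::euclidean_space \<Rightarrow> real) \<Rightarrow> bool" where
  "test_fun \<phi> \<longleftrightarrow> smooth_on (UNIV - {0}) \<phi> \<and>
     compact (closure {x. \<phi> x \<noteq> 0}) \<and> 0 \<notin> closure {x. \<phi> x \<noteq> 0}"

text \<open>(u, g) represents an element of D^{1,2}_a with (weak) gradient g: u and g arise as
  limit of test functions phi_k, with grad phi_k -> g in L^2(|x|^{-2a} dx) and phi_k -> u a.e.\<close>
definition D12 :: "real \<Rightarrow> ('a::euclidean_space \<Rightarrow> real) \<Rightarrow> ('a \<Rightarrow> 'a) \<Rightarrow> bool" where
  "D12 a u g \<longleftrightarrow> u \<in> borel_measurable lborel \<and> g \<in> borel_measurable lborel \<and>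
     (\<exists>\<phi> :: nat \<Rightarrow> 'a \<Rightarrow> real. (\<forall>k. test_fun (\<phi> k)) \<and>
        ((\<lambda>k. \<integral>\<^sup>+ x. ennreal ((norm (grad (\<phi> k) x - g x))\<^sup>2 * norm x powr (-2*a)) \<partial>lborel)
            \<longlonglongrightarrow> 0) \<and>
        (AE x in lborel. (\<lambda>k. \<phi> k x) \<longlonglongrightarrow> u x))"

definition energy :: "real \<Rightarrow> ('a::euclidean_space \<Rightarrow> 'a) \<Rightarrow> real" where
  "energy a g = (\<integral>x. (norm (g x))\<^sup>2 * norm x powr (-2*a) \<partial>lborel)"

definition wLp :: "real \<Rightarrow> real \<Rightarrow> ('a::euclidean_space \<Rightarrow> real) \<Rightarrow> real" where
  "wLp b p u = (\<integral>x. \<bar>u x\<bar> powr p * norm x powr (-b*p) \<partial>lborel)"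

text \<open>Optimal CKN constant C_{a,b} (p is determined by a, b, d).\<close>
definition CKN_const :: "'a::euclidean_space itself \<Rightarrow> real \<Rightarrow> real \<Rightarrow> real \<Rightarrow> real" where
  "CKN_const _ a b p = Inf {C. \<forall>(u::'a \<Rightarrow> real) g. D12 a u g \<longrightarrow> wLp b p u powr (2/p) \<le> C * energy a g}"

text \<open>v = L_a w in the weak sense: -div(|x|^{-2a} grad w) = |x|^{-2a} v tested against C_c^infinity(R^d minus 0).\<close>
definition La_weak :: "real \<Rightarrow> ('a::euclidean_space \<Rightarrow> real) \<Rightarrow> ('a \<Rightarrow> 'a) \<Rightarrow> ('a \<Rightarrow> real) \<Rightarrow> bool" where
  "La_weak a w gw v \<longleftrightarrow> (\<forall>\<phi>. test_fun \<phi> \<longrightarrow>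
     (\<integral>x. v x * \<phi> x * norm x powr (-2*a) \<partial>lborel) =
     (\<integral>x. (gw x \<bullet> grad \<phi> x) * norm x powr (-2*a) \<partial>lborel))"

definition admissible :: "nat \<Rightarrow> real \<Rightarrow> real \<Rightarrow> real \<Rightarrow> bool" where
  "admissible d a b p \<longleftrightarrow> d \<ge> 1 \<and>
     (let ac = (real d - 2) / 2 in
       p \<ge> 2 \<and> (d \<ge> 3 \<longrightarrow> p \<le> 2 * real d / (real d - 2)) \<and>
       b = a - ac + real d / p \<and> a < ac \<and>
       (d \<ge> 3 \<longrightarrow> a \<le> b \<and> b \<le> a + 1) \<and>
       (d = 2 \<longrightarrow> a < b \<and> b \<le> a + 1) \<and>
       (d = 1 \<longrightarrow> a + 1/2 < b \<and> b \<le> a + 1))"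

end

theory Submission
  imports Defs
begin

text \<open>
  Write \<open>M\<close> for the squared weighted norm of \<open>u\<close>. The choice of \<open>v\<close> makes its squared dual norm and
  \<open>\<langle>v, u\<rangle>\<close> both equal to \<open>M\<close>, and testing the equation for \<open>w\<close> gives \<open>\<langle>v, w\<rangle> = \<parallel>\<nabla>w\<parallel>\<^sup>2\<close> and
  \<open>M = \<langle>\<nabla>w, \<nabla>u\<rangle>\<close> in the weighted \<open>L\<^sup>2\<close> space. The lower bound is duality together with the inequality
  for \<open>w\<close>; the upper bound is \<open>2M \<le> C \<parallel>\<nabla>u\<parallel>\<^sup>2 + \<parallel>\<nabla>w\<parallel>\<^sup>2 / C\<close>.

  The constant is an infimum of reals, so this argument needs a finite admissible constant, i.e. the
  Caffarelli-Kohn-Nirenberg inequality itself. For \<open>d \<ge> 2\<close>, apply the \<open>L\<^sup>1\<close> Gagliardo-Nirenberg inequality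
  to \<open>|x|\<^sup>-\<^sup>\<gamma> |f|\<^sup>s\<close>. Bounding the gradient by Cauchy-Schwarz and Hardy's inequality controls the
  scale-invariant integral with exponent \<open>p = s d / (d - 1)\<close> by the one with exponent \<open>2 (s - 1)\<close>.
  As long as \<open>p\<close> is at most critical, the latter exponent lies between \<open>2\<close> and \<open>p\<close>, so by log-convexity
  it is dominated by the Hardy integral and a power of the former small enough to be absorbed. The
  remaining exponents follow by interpolation with Hardy's inequality. For \<open>d = 1\<close> the same weighted
  power is bounded uniformly.
\<close>

subsection \<open>Hoelder's inequality\<close>

lemma weighted_arith_geom_mean:
  fixes w x :: "'i \<Rightarrow> real"
  assumes S: "finite S" and w: "\<And>i. i \<in> S \<Longrightarrow> 0 \<le> w i" "sum w S = 1"
    and x: "\<And>i. i \<in> S \<Longrightarrow> 0 \<le> x i"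
  shows "(\<Prod>i\<in>S. x i powr w i) \<le> (\<Sum>i\<in>S. w i * x i)"
proof (cases "\<exists>i\<in>S. x i = 0")
  case True
  then have "(\<Prod>i\<in>S. x i powr w i) = 0"
    using S by auto
  then show ?thesis
    using w x by (simp add: sum_nonneg)
next
  case False
  then have pos: "0 < x i" if "i \<in> S" for i
    using x[OF that] that by (auto simp: less_le)
  have "S \<noteq> {}" using w(2) by auto
  have "(\<Prod>i\<in>S. x i powr w i) = exp (\<Sum>i\<in>S. w i *\<^sub>R ln (x i))"
    using S False by (auto simp: exp_sum powr_def intro!: prod.cong)
  also have "\<dots> \<le> (\<Sum>i\<in>S. w i * exp (ln (x i)))"
    by (intro convex_on_sum[OF S \<open>S \<noteq> {}\<close> exp_convex]) (use w in auto)
  also have "\<dots> = (\<Sum>i\<in>S. w i * x i)"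
    using pos by simp
  finally show ?thesis .
qed

definition epowr :: "ennreal \<Rightarrow> real \<Rightarrow> ennreal" where
  "epowr x r = (if x = top then top else ennreal (enn2real x powr r))"

lemma epowr_ennreal: "0 \<le> x \<Longrightarrow> epowr (ennreal x) r = ennreal (x powr r)"
  by (simp add: epowr_def)

lemma epowr_top [simp]: "epowr top r = top"
  by (simp add: epowr_def)

lemma epowr_eq_0_iff [simp]: "epowr x r = 0 \<longleftrightarrow> x = 0"
  by (cases x) (auto simp: epowr_ennreal ennreal_eq_0_iff)

lemma epowr_mono: "x \<le> y \<Longrightarrow> 0 \<le> r \<Longrightarrow> epowr x r \<le> epowr y r"
  by (cases x; cases y) (auto simp: epowr_ennreal top_unique intro!: ennreal_leI powr_mono2)

lemma epowr_mult_ennreal: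
  assumes "0 < c"
  shows "epowr (ennreal c * x) r = ennreal (c powr r) * epowr x r"
  using assms
  by (cases x) (simp_all add: epowr_ennreal powr_mult ennreal_mult_top ennreal_mult'[symmetric])

lemma borel_measurable_epowr [measurable (raw)]:
  assumes [measurable]: "f \<in> borel_measurable M"
  shows "(\<lambda>x. epowr (f x) r) \<in> borel_measurable M"
  unfolding epowr_def by (intro measurable_If measurable_compose[OF _ measurable_ennreal]) auto

lemma prod_epowr_le_sum:
  fixes f :: "'i \<Rightarrow> ennreal"
  assumes S: "finite S" and w: "\<And>i. i \<in> S \<Longrightarrow> 0 \<le> w i" "sum w S = 1"
    and f: "\<And>i. i \<in> S \<Longrightarrow> f i \<noteq> top"
  shows "(\<Prod>i\<in>S. epowr (f i) (w i)) \<le> (\<Sum>i\<in>S. ennreal (w i) * f i)"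
proof -
  define y where "y i = enn2real (f i)" for i
  have y: "f i = ennreal (y i)" "0 \<le> y i" if "i \<in> S" for i
    using f[OF that] by (simp_all add: y_def less_top)
  have "(\<Prod>i\<in>S. epowr (f i) (w i)) = ennreal (\<Prod>i\<in>S. y i powr w i)"
    using y by (simp add: epowr_ennreal prod_ennreal)
  also have "\<dots> \<le> ennreal (\<Sum>i\<in>S. w i * y i)"
    by (intro ennreal_leI weighted_arith_geom_mean S w y)
  also have "\<dots> = (\<Sum>i\<in>S. ennreal (w i) * f i)"
    using w y by (simp add: ennreal_mult sum_ennreal[symmetric])
  finally show ?thesis .
qed

lemma Holder_nn_integral_prod_finite:
  fixes F :: "'i \<Rightarrow> 'a \<Rightarrow> ennreal"
  assumes S: "finite S" and [measurable]: "\<And>i. i \<in> S \<Longrightarrow> F i \<in> borel_measurable M"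
    and w: "\<And>i. i \<in> S \<Longrightarrow> 0 \<le> w i" "sum w S = 1"
    and c: "\<And>i. i \<in> S \<Longrightarrow> (\<integral>\<^sup>+x. F i x \<partial>M) = ennreal (c i)" "\<And>i. i \<in> S \<Longrightarrow> 0 < c i"
  shows "(\<integral>\<^sup>+x. (\<Prod>i\<in>S. epowr (F i x) (w i)) \<partial>M) \<le> (\<Prod>i\<in>S. ennreal (c i powr w i))"
proof -
  define P where "P = (\<Prod>i\<in>S. ennreal (c i powr w i))"
  have normalize: "F i x = ennreal (c i) * (ennreal (1 / c i) * F i x)" if "i \<in> S" for i x
    using c(2)[OF that] by (simp add: mult.assoc[symmetric] ennreal_mult[symmetric])
  have "AE x in M. F i x \<noteq> \<infinity>" if "i \<in> S" for i
    by (rule nn_integral_PInf_AE) (use that c in auto)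
  then have "AE x in M. \<forall>i\<in>S. F i x \<noteq> \<infinity>"
    using S by (simp add: AE_finite_all)
  then have "AE x in M. (\<Prod>i\<in>S. epowr (F i x) (w i)) \<le> P * (\<Sum>i\<in>S. ennreal (w i) * (ennreal (1 / c i) * F i x))"
  proof eventually_elim
    fix x assume fin: "\<forall>i\<in>S. F i x \<noteq> \<infinity>"
    have "(\<Prod>i\<in>S. epowr (F i x) (w i)) = (\<Prod>i\<in>S. epowr (ennreal (c i) * (ennreal (1 / c i) * F i x)) (w i))"
      using normalize by simp
    also have "\<dots> = P * (\<Prod>i\<in>S. epowr (ennreal (1 / c i) * F i x) (w i))"
      using c by (simp add: P_def epowr_mult_ennreal[of "c _"] prod.distrib)
    also have "\<dots> \<le> P * (\<Sum>i\<in>S. ennreal (w i) * (ennreal (1 / c i) * F i x))"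
      using fin by (intro mult_left_mono prod_epowr_le_sum S w) (auto simp: ennreal_mult_eq_top_iff)
    finally show "(\<Prod>i\<in>S. epowr (F i x) (w i)) \<le> P * (\<Sum>i\<in>S. ennreal (w i) * (ennreal (1 / c i) * F i x))" .
  qed
  then have "(\<integral>\<^sup>+x. (\<Prod>i\<in>S. epowr (F i x) (w i)) \<partial>M)
      \<le> (\<integral>\<^sup>+x. P * (\<Sum>i\<in>S. ennreal (w i) * (ennreal (1 / c i) * F i x)) \<partial>M)"
    by (rule nn_integral_mono_AE)
  also have "\<dots> = P * (\<Sum>i\<in>S. ennreal (w i) * (ennreal (1 / c i) * ennreal (c i)))"
    using c by (simp add: nn_integral_cmult nn_integral_sum)
  also have "\<dots> = P * (\<Sum>i\<in>S. ennreal (w i))"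
    using c(2) by (simp add: ennreal_mult[symmetric] less_imp_le less_imp_neq[symmetric])
  also have "\<dots> = P"
    using w by (simp add: sum_ennreal)
  finally show ?thesis unfolding P_def .
qed

text \<open>Since \<open>0 powr 0 = 0\<close> and \<open>epowr top 0 = top\<close>, vanishing weights need no separate treatment.\<close>
theorem Holder_nn_integral_prod:
  fixes F :: "'i \<Rightarrow> 'a \<Rightarrow> ennreal"
  assumes S: "finite S" and F [measurable]: "\<And>i. i \<in> S \<Longrightarrow> F i \<in> borel_measurable M"
    and w: "\<And>i. i \<in> S \<Longrightarrow> 0 \<le> w i" "sum w S = 1"
  shows "(\<integral>\<^sup>+x. (\<Prod>i\<in>S. epowr (F i x) (w i)) \<partial>M) \<le> (\<Prod>i\<in>S. epowr (\<integral>\<^sup>+x. F i x \<partial>M) (w i))"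
proof -
  define I where "I i = (\<integral>\<^sup>+x. F i x \<partial>M)" for i
  consider (zero) i where "i \<in> S" "I i = 0"
    | (top) i where "i \<in> S" "I i = top" "\<And>j. j \<in> S \<Longrightarrow> I j \<noteq> 0"
    | (fin) "\<And>j. j \<in> S \<Longrightarrow> I j \<noteq> 0 \<and> I j \<noteq> top"
    by blast
  then show ?thesis
  proof cases
    case zero
    then have "AE x in M. F i x = 0"
      by (simp add: I_def nn_integral_0_iff_AE)
    then have "AE x in M. (\<Prod>i\<in>S. epowr (F i x) (w i)) = 0"
      by eventually_elim (use zero S in auto)
    then have "(\<integral>\<^sup>+x. (\<Prod>i\<in>S. epowr (F i x) (w i)) \<partial>M) = (\<integral>\<^sup>+x. 0 \<partial>M)"
      by (rule nn_integral_cong_AE)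
    then show ?thesis by simp
  next
    case top
    then have "(\<Prod>j\<in>S. epowr (I j) (w j)) = top"
      using S by (simp add: prod.remove ennreal_top_mult prod_zero_iff)
    then show ?thesis by (simp add: I_def)
  next
    case fin
    have I: "I i = ennreal (enn2real (I i))" "0 < enn2real (I i)" if "i \<in> S" for i
      using fin[OF that] by (auto simp: less_top enn2real_positive_iff zero_less_iff_neq_zero)
    then have "epowr (I i) (w i) = ennreal (enn2real (I i) powr w i)" if "i \<in> S" for i
      using that fin by (simp add: epowr_def)
    with Holder_nn_integral_prod_finite[OF S F w, where c = "\<lambda>i. enn2real (I i)"] I show ?thesis
      by (simp add: I_def)
  qed
qed

corollary Holder_integral:
  fixes F G :: "'a \<Rightarrow> real"
  assumes F: "integrable M F" and G: "integrable M G"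
    and F0: "\<And>x. 0 \<le> F x" and G0: "\<And>x. 0 \<le> G x" and l: "0 \<le> l" "l \<le> 1"
  shows Holder_integrable: "integrable M (\<lambda>x. F x powr l * G x powr (1 - l))"
    and Holder_integral_le:
      "(\<integral>x. F x powr l * G x powr (1 - l) \<partial>M) \<le> (\<integral>x. F x \<partial>M) powr l * (\<integral>x. G x \<partial>M) powr (1 - l)"
proof -
  have [measurable]: "F \<in> borel_measurable M" "G \<in> borel_measurable M"
    using F G by auto
  define B where "B = (\<integral>x. F x \<partial>M) powr l * (\<integral>x. G x \<partial>M) powr (1 - l)"
  have "(\<integral>\<^sup>+x. ennreal (F x powr l * G x powr (1 - l)) \<partial>M)
      = (\<integral>\<^sup>+x. (\<Prod>i\<in>UNIV. epowr (ennreal (if i then F x else G x)) (if i then l else 1 - l)) \<partial>M)"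
    using F0 G0 by (simp add: UNIV_bool epowr_ennreal ennreal_mult mult.commute)
  also have "\<dots> \<le> (\<Prod>i\<in>UNIV. epowr (\<integral>\<^sup>+x. ennreal (if i then F x else G x) \<partial>M) (if i then l else 1 - l))"
    by (rule Holder_nn_integral_prod) (use l in \<open>auto simp: UNIV_bool\<close>)
  also have "\<dots> = ennreal B"
    using F G F0 G0
    by (simp add: B_def UNIV_bool epowr_ennreal nn_integral_eq_integral ennreal_mult mult.commute)
  finally have le: "(\<integral>\<^sup>+x. ennreal (F x powr l * G x powr (1 - l)) \<partial>M) \<le> ennreal B" .
  show int: "integrable M (\<lambda>x. F x powr l * G x powr (1 - l))"
    by (rule integrableI_nonneg) (use le in \<open>auto intro: le_less_trans\<close>)
  have "0 \<le> B" by (simp add: B_def)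
  then show "(\<integral>x. F x powr l * G x powr (1 - l) \<partial>M) \<le> (\<integral>x. F x \<partial>M) powr l * (\<integral>x. G x \<partial>M) powr (1 - l)"
    using le int by (simp add: nn_integral_eq_integral ennreal_le_iff B_def[symmetric])
qed

lemma
  fixes F G h :: "'a \<Rightarrow> real"
  assumes F: "integrable M F" and G: "integrable M G"
    and F0: "\<And>x. 0 \<le> F x" and G0: "\<And>x. 0 \<le> G x" and l: "0 \<le> l" "l \<le> 1"
    and h: "h \<in> borel_measurable M" "\<And>x. \<bar>h x\<bar> \<le> F x powr l * G x powr (1 - l)"
  shows integrable_if_le_Holder: "integrable M h"
    and abs_integral_le_Holder: "\<bar>\<integral>x. h x \<partial>M\<bar> \<le> (\<integral>x. F x \<partial>M) powr l * (\<integral>x. G x \<partial>M) powr (1 - l)"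
proof -
  note Holder = Holder_integral[OF F G F0 G0 l]
  show int: "integrable M h"
    by (rule Bochner_Integration.integrable_bound[OF Holder(1) h(1)]) (use h(2) in auto)
  have "\<bar>\<integral>x. h x \<partial>M\<bar> \<le> (\<integral>x. \<bar>h x\<bar> \<partial>M)"
    by (rule integral_abs_bound)
  also have "\<dots> \<le> (\<integral>x. F x powr l * G x powr (1 - l) \<partial>M)"
    by (rule integral_mono[OF integrable_abs[OF int] Holder(1) h(2)])
  also note Holder(2)
  finally show "\<bar>\<integral>x. h x \<partial>M\<bar> \<le> (\<integral>x. F x \<partial>M) powr l * (\<integral>x. G x \<partial>M) powr (1 - l)" .
qed

subsection \<open>The Loomis-Whitney inequality\<close>

definition line_int :: "'a::euclidean_space \<Rightarrow> ('a \<Rightarrow> ennreal) \<Rightarrow> 'a \<Rightarrow> ennreal" where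
  "line_int e f x = (\<integral>\<^sup>+t. f (x + t *\<^sub>R e) \<partial>lborel)"

definition partial_int :: "'a::euclidean_space set \<Rightarrow> ('a \<Rightarrow> ennreal) \<Rightarrow> 'a \<Rightarrow> ennreal" where
  "partial_int J f x = (\<integral>\<^sup>+y. f (x + (\<Sum>b\<in>J. y b *\<^sub>R b)) \<partial>(\<Pi>\<^sub>M b\<in>J. lborel))"

lemma borel_measurable_line_int [measurable]:
  assumes [measurable]: "f \<in> borel_measurable borel"
  shows "line_int e f \<in> borel_measurable borel"
  unfolding line_int_def by (rule lborel.borel_measurable_nn_integral) measurable

lemma line_int_shift:
  assumes [measurable]: "f \<in> borel_measurable borel"
  shows "line_int e f (x + s *\<^sub>R e) = line_int e f x"
  unfolding line_int_def
  by (subst (2) nn_integral_real_affine[of _ 1 s]) (auto simp: algebra_simps)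

lemma line_int_mono: "(\<And>x. f x \<le> g x) \<Longrightarrow> line_int e f x \<le> line_int e g x"
  unfolding line_int_def by (intro nn_integral_mono)

lemma partial_int_empty [simp]: "partial_int {} f = f"
  by (simp add: partial_int_def PiM_empty fun_eq_iff)

lemma partial_int_insert:
  fixes f :: "'a::euclidean_space \<Rightarrow> ennreal"
  assumes [measurable]: "f \<in> borel_measurable borel" and J: "finite J" "j \<notin> J"
  shows "partial_int (insert j J) f = line_int j (partial_int J f)"
proof
  fix x :: 'a
  interpret product_sigma_finite "\<lambda>_::'a. lborel :: real measure" ..
  have split: "x + (\<Sum>b\<in>insert j J. (y(j := t)) b *\<^sub>R b) = x + t *\<^sub>R j + (\<Sum>b\<in>J. y b *\<^sub>R b)"
    for y :: "'a \<Rightarrow> real" and t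
  proof -
    have "(\<Sum>b\<in>J. (y(j := t)) b *\<^sub>R b) = (\<Sum>b\<in>J. y b *\<^sub>R b)"
      using J by (intro sum.cong) auto
    then show ?thesis
      using J by (simp del: fun_upd_apply) (simp add: add_ac)
  qed
  have "partial_int (insert j J) f x
      = (\<integral>\<^sup>+t. \<integral>\<^sup>+y. f (x + (\<Sum>b\<in>insert j J. (y(j := t)) b *\<^sub>R b)) \<partial>(\<Pi>\<^sub>M b\<in>J. lborel) \<partial>lborel)"
    unfolding partial_int_def by (rule product_nn_integral_insert_rev) (use J in measurable)
  then show "partial_int (insert j J) f x = line_int j (partial_int J f) x"
    by (simp only: split line_int_def partial_int_def)
qed

lemma partial_int_singleton:
  "f \<in> borel_measurable borel \<Longrightarrow> partial_int {j} f = line_int j f"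
  by (simp add: partial_int_insert)

lemma borel_measurable_partial_int [measurable]:
  assumes [measurable]: "f \<in> borel_measurable borel" and J: "finite J"
  shows "partial_int J f \<in> borel_measurable borel"
  using J by induction (auto simp: partial_int_insert)

lemma partial_int_shift:
  assumes "f \<in> borel_measurable borel" "finite J" "j \<in> J"
  shows "partial_int J f (x + t *\<^sub>R j) = partial_int J f x"
proof -
  have "partial_int J f = line_int j (partial_int (J - {j}) f)"
    using assms partial_int_insert[of f "J - {j}" j] by (simp add: insert_absorb)
  then show ?thesis
    using assms by (simp add: line_int_shift)
qed

lemma partial_int_Basis:
  fixes f :: "'a::euclidean_space \<Rightarrow> ennreal"
  assumes [measurable]: "f \<in> borel_measurable borel"
  shows "partial_int Basis f x = (\<integral>\<^sup>+y. f y \<partial>lborel)"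
proof -
  have "partial_int Basis f x = (\<integral>\<^sup>+y. f (x + y) \<partial>distr (\<Pi>\<^sub>M b\<in>Basis. lborel) borel (\<lambda>y. \<Sum>b\<in>Basis. y b *\<^sub>R b))"
    unfolding partial_int_def by (rule nn_integral_distr[symmetric]) measurable
  also have "\<dots> = (\<integral>\<^sup>+y. f (x + y) \<partial>lborel)"
    by (simp flip: lborel_eq)
  also have "\<dots> = (\<integral>\<^sup>+y. f y \<partial>distr lborel borel ((+) x))"
    by (rule nn_integral_distr[symmetric]) measurable
  finally show ?thesis
    by (simp add: lborel_distr_plus)
qed

lemma line_int_mult_prod_le:
  fixes c :: "'a::euclidean_space \<Rightarrow> ennreal"
  assumes I: "finite I" "I \<noteq> {}" and [measurable]: "c \<in> borel_measurable borel"
    "\<And>i. i \<in> I \<Longrightarrow> B i \<in> borel_measurable borel"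
    and shift: "\<And>t. c (x + t *\<^sub>R e) = c x"
  shows "line_int e (\<lambda>x. c x * (\<Prod>i\<in>I. epowr (B i x) (1 / card I))) x
    \<le> c x * (\<Prod>i\<in>I. epowr (line_int e (B i) x) (1 / card I))"
proof -
  have "line_int e (\<lambda>x. c x * (\<Prod>i\<in>I. epowr (B i x) (1 / card I))) x
      = c x * (\<integral>\<^sup>+t. (\<Prod>i\<in>I. epowr (B i (x + t *\<^sub>R e)) (1 / card I)) \<partial>lborel)"
    unfolding line_int_def shift by (rule nn_integral_cmult) measurable
  also have "\<dots> \<le> c x * (\<Prod>i\<in>I. epowr (\<integral>\<^sup>+t. B i (x + t *\<^sub>R e) \<partial>lborel) (1 / card I))"
    by (intro mult_left_mono Holder_nn_integral_prod) (use I in auto)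
  finally show ?thesis by (simp add: line_int_def)
qed

lemma partial_int_prod_line_int_le:
  fixes g :: "'a::euclidean_space \<Rightarrow> ennreal"
  assumes g [measurable]: "g \<in> borel_measurable borel" and d: "2 \<le> DIM('a)"
    and J: "finite J" "J \<subseteq> Basis"
  defines "m \<equiv> 1 / (real DIM('a) - 1)"
  shows "partial_int J (\<lambda>x. \<Prod>i\<in>Basis. epowr (line_int i g x) m) x
    \<le> (\<Prod>i\<in>Basis. epowr (partial_int (insert i J) g x) m)"
  using J
proof (induction arbitrary: x)
  case empty
  then show ?case by (simp add: partial_int_singleton)
next
  case (insert j J)
  let ?h = "\<lambda>x. \<Prod>i\<in>Basis. epowr (line_int i g x) m"
  let ?g = "\<lambda>i. partial_int (insert i J) g"
  have j: "j \<in> Basis" "finite J" "j \<notin> J" using insert by auto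
  have m: "m = 1 / card (Basis - {j})" and ne: "Basis - {j} \<noteq> {}"
  proof -
    have card: "card (Basis - {j}) = DIM('a) - 1"
      using j by (simp add: card_Diff_singleton)
    then show "m = 1 / card (Basis - {j})"
      using d by (simp add: m_def of_nat_diff)
    have "0 < card (Basis - {j})"
      using card d by linarith
    then show "Basis - {j} \<noteq> {}"
      using card_gt_0_iff by blast
  qed
  have "partial_int (insert j J) ?h x = line_int j (partial_int J ?h) x"
    using j by (simp add: partial_int_insert)
  also have "\<dots> \<le> line_int j (\<lambda>x. \<Prod>i\<in>Basis. epowr (?g i x) m) x"
    using insert by (intro line_int_mono) auto
  also have "\<dots> = line_int j (\<lambda>x. epowr (?g j x) m * (\<Prod>i\<in>Basis - {j}. epowr (?g i x) m)) x"
    by (simp add: prod.remove[OF finite_Basis j(1)])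
  also have "\<dots> \<le> epowr (?g j x) m * (\<Prod>i\<in>Basis - {j}. epowr (line_int j (?g i) x) m)"
    unfolding m by (intro line_int_mult_prod_le) (use j ne in \<open>auto simp: partial_int_shift\<close>)
  also have "\<dots> = (\<Prod>i\<in>Basis. epowr (partial_int (insert i (insert j J)) g x) m)"
  proof -
    have "line_int j (?g i) = partial_int (insert i (insert j J)) g" if "i \<noteq> j" for i
      using partial_int_insert[OF g, of "insert i J" j] j that by (simp add: insert_commute)
    then show ?thesis
      by (simp add: prod.remove[OF finite_Basis j(1)])
  qed
  finally show ?case .
qed

theorem Loomis_Whitney:
  fixes g :: "'a::euclidean_space \<Rightarrow> ennreal"
  assumes [measurable]: "g \<in> borel_measurable borel" and d: "2 \<le> DIM('a)"
  shows "(\<integral>\<^sup>+x. (\<Prod>i\<in>Basis. epowr (line_int i g x) (1 / (real DIM('a) - 1))) \<partial>lborel)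
    \<le> epowr (\<integral>\<^sup>+x. g x \<partial>lborel) (1 / (real DIM('a) - 1)) ^ DIM('a)"
  using partial_int_prod_line_int_le[of g Basis 0] d by (simp add: insert_absorb partial_int_Basis)

subsection \<open>Compactly supported functions of class \<open>C\<^sup>1\<close>\<close>

definition C1c_on :: "'a::euclidean_space set \<Rightarrow> ('a \<Rightarrow> real) \<Rightarrow> ('a \<Rightarrow> 'a) \<Rightarrow> bool" where
  "C1c_on S f G \<longleftrightarrow> continuous_on UNIV f \<and> continuous_on UNIV G \<and>
     (\<exists>K. compact K \<and> K \<subseteq> S \<and> (\<forall>x. x \<notin> K \<longrightarrow> f x = 0 \<and> G x = 0)) \<and>
     (\<forall>x. \<forall>e\<in>Basis. ((\<lambda>t. f (x + t *\<^sub>R e)) has_real_derivative G x \<bullet> e) (at 0))"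

lemma C1c_on_continuous:
  assumes "C1c_on S f G"
  shows "continuous_on A f" "continuous_on A G"
  using assms continuous_on_subset unfolding C1c_on_def by blast+

lemma C1c_on_support:
  assumes "C1c_on S f G"
  obtains K where "compact K" "K \<subseteq> S" "\<And>x. x \<notin> K \<Longrightarrow> f x = 0" "\<And>x. x \<notin> K \<Longrightarrow> G x = 0"
  using assms unfolding C1c_on_def by blast

lemma C1c_on_has_real_derivative:
  "C1c_on S f G \<Longrightarrow> e \<in> Basis \<Longrightarrow> ((\<lambda>t. f (x + t *\<^sub>R e)) has_real_derivative G x \<bullet> e) (at 0)"
  unfolding C1c_on_def by blast

lemma C1c_on_measurable:
  assumes "C1c_on S f G"
  shows "f \<in> borel_measurable borel" "G \<in> borel_measurable borel"
  using C1c_on_continuous[OF assms] by (auto intro: borel_measurable_continuous_onI)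

lemma C1c_on_diff:
  assumes f: "C1c_on S f G" and h: "C1c_on S h H"
  shows "C1c_on S (\<lambda>x. f x - h x) (\<lambda>x. G x - H x)"
proof -
  obtain K where K: "compact K" "K \<subseteq> S" "\<And>x. x \<notin> K \<Longrightarrow> f x = 0" "\<And>x. x \<notin> K \<Longrightarrow> G x = 0"
    by (rule C1c_on_support[OF f]) blast
  obtain L where L: "compact L" "L \<subseteq> S" "\<And>x. x \<notin> L \<Longrightarrow> h x = 0" "\<And>x. x \<notin> L \<Longrightarrow> H x = 0"
    by (rule C1c_on_support[OF h]) blast
  have "compact (K \<union> L) \<and> K \<union> L \<subseteq> S \<and> (\<forall>x. x \<notin> K \<union> L \<longrightarrow> f x - h x = 0 \<and> G x - H x = 0)"
    using K L by (auto simp: compact_Un)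
  then show ?thesis
    using assms unfolding C1c_on_def
    by (auto simp: inner_diff_left intro!: continuous_intros derivative_intros)
qed

lemma integrable_continuous_compact:
  fixes h :: "'a::euclidean_space \<Rightarrow> 'b::{banach, second_countable_topology}"
  assumes "continuous_on UNIV h" "compact K" "\<And>x. x \<notin> K \<Longrightarrow> h x = 0"
  shows "integrable lborel h"
proof -
  have "integrable lborel (\<lambda>x. indicator K x *\<^sub>R h x)"
    using assms by (intro borel_integrable_compact) (auto intro: continuous_on_subset)
  moreover have "(\<lambda>x. indicator K x *\<^sub>R h x) = h"
    using assms(3) by (auto simp: indicator_def fun_eq_iff)
  ultimately show ?thesis by simp
qed

lemma C1c_on_integrable:
  assumes f: "C1c_on S f G" and F: "continuous_on UNIV F" "\<And>x. f x = 0 \<Longrightarrow> G x = 0 \<Longrightarrow> F x = 0"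
  shows "integrable lborel (F :: _ \<Rightarrow> real)"
proof -
  obtain K where "compact K" "\<And>x. x \<notin> K \<Longrightarrow> f x = 0" "\<And>x. x \<notin> K \<Longrightarrow> G x = 0"
    by (rule C1c_on_support[OF f]) blast
  then show ?thesis
    using F by (intro integrable_continuous_compact[of F K]) auto
qed

lemma C1c_on_integrable_grad:
  assumes "C1c_on S f G"
  shows "integrable lborel (\<lambda>x. norm (G x))"
  by (rule C1c_on_integrable[OF assms]) (auto intro!: continuous_intros C1c_on_continuous[OF assms])

lemma continuous_on_UNIV_if_compact_support:
  fixes h :: "'a::t2_space \<Rightarrow> 'b::topological_space"
  assumes "continuous_on S h" "open S" "compact K" "K \<subseteq> S" "\<And>x. x \<notin> K \<Longrightarrow> h x = c"
  shows "continuous_on UNIV h"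
proof -
  have "continuous_on (- K) h"
    by (rule continuous_on_eq[of _ "\<lambda>_. c"]) (use assms in auto)
  then have "continuous_on (S \<union> - K) h"
    using assms by (intro continuous_on_open_Un) (auto simp: compact_imp_closed)
  moreover have "S \<union> - K = UNIV" using assms by auto
  ultimately show ?thesis by simp
qed

lemma has_real_derivative_0_off_compact:
  fixes f :: "'a::euclidean_space \<Rightarrow> real"
  assumes K: "compact K" and x: "x \<notin> K" and f: "\<And>y. y \<notin> K \<Longrightarrow> f y = 0"
  shows "((\<lambda>t. f (x + t *\<^sub>R e)) has_real_derivative 0) (at 0)"
proof (rule has_field_derivative_transform_within_open)
  show "open ((\<lambda>t. x + t *\<^sub>R e) -` (- K))"
    by (intro open_vimage continuous_intros open_Compl compact_imp_closed K)
  show "((\<lambda>_. 0) has_real_derivative 0) (at 0)" by simp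
qed (use x f in auto)

lemma C1c_onI_support:
  fixes f :: "'a::euclidean_space \<Rightarrow> real"
  assumes S: "open S" and f: "continuous_on S f" and G: "continuous_on S G"
    and K: "compact K" "K \<subseteq> S" "\<And>x. x \<notin> K \<Longrightarrow> f x = 0" "\<And>x. x \<notin> K \<Longrightarrow> G x = 0"
    and deriv: "\<And>x e. x \<in> S \<Longrightarrow> e \<in> Basis \<Longrightarrow>
      ((\<lambda>t. f (x + t *\<^sub>R e)) has_real_derivative G x \<bullet> e) (at 0)"
  shows "C1c_on S f G"
proof -
  have "((\<lambda>t. f (x + t *\<^sub>R e)) has_real_derivative G x \<bullet> e) (at 0)" if e: "e \<in> Basis" for x e
  proof (cases "x \<in> S")
    case False
    then have "x \<notin> K" using K by blast
    then show ?thesis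
      using has_real_derivative_0_off_compact[OF K(1) _ K(3)] K(4) by simp
  qed (use deriv e in blast)
  then show ?thesis
    unfolding C1c_on_def
    using continuous_on_UNIV_if_compact_support[OF f S K(1-3)]
      continuous_on_UNIV_if_compact_support[OF G S K(1,2,4)] K by blast
qed

lemma test_fun_C1c_on:
  fixes \<phi> :: "'a::euclidean_space \<Rightarrow> real"
  assumes "test_fun \<phi>"
  shows "C1c_on (- {0}) \<phi> (grad \<phi>)"
proof -
  define K where "K = closure {x. \<phi> x \<noteq> 0}"
  have K: "compact K" "K \<subseteq> - {0}" and sm: "smooth_on (- {0}) \<phi>"
    using assms by (auto simp: test_fun_def K_def Compl_eq_Diff_UNIV)
  have \<phi>0: "\<phi> x = 0" if "x \<notin> K" for x
    using that closure_subset[of "{x. \<phi> x \<noteq> 0}"] unfolding K_def by auto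
  have "pderiv_list [e] \<phi> x = 0" if "x \<notin> K" for x e
    using DERIV_imp_deriv[OF has_real_derivative_0_off_compact[OF K(1) that \<phi>0]] by simp
  then have grad0: "grad \<phi> x = 0" if "x \<notin> K" for x
    unfolding grad_def using that by (simp del: pderiv_list.simps)
  have grad_inner: "grad \<phi> x \<bullet> e = pderiv_list [e] \<phi> x" if "e \<in> Basis" for x e
    using that unfolding grad_def by (simp add: inner_sum_left_Basis del: pderiv_list.simps)
  have cont: "continuous_on (- {0}) (pderiv_list es \<phi>)" if "set es \<subseteq> Basis" for es
    using sm that unfolding smooth_on_def by blast
  show ?thesis
  proof (rule C1c_onI_support[OF _ _ _ K \<phi>0 grad0])
    show "continuous_on (- {0}) \<phi>"
      using cont[of "[]"] by simp
    show "continuous_on (- {0}) (grad \<phi>)"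
      unfolding grad_def using cont by (intro continuous_intros) (auto simp del: pderiv_list.simps)
    show "((\<lambda>t. \<phi> (x + t *\<^sub>R e)) has_real_derivative grad \<phi> x \<bullet> e) (at 0)"
      if "x \<in> - {0}" "e \<in> Basis" for x e
    proof -
      have "\<forall>e\<in>Basis. \<forall>x\<in>- {0}. ((\<lambda>t. pderiv_list [] \<phi> (x + t *\<^sub>R e)) has_real_derivative
          pderiv_list [e] \<phi> x) (at 0)"
        using sm unfolding smooth_on_def by (metis empty_set empty_subsetI)
      then show ?thesis
        using that by (simp add: grad_inner del: pderiv_list.simps(2))
    qed
  qed auto
qed

subsection \<open>Powers and radial weights\<close>

definition signed_powr :: "real \<Rightarrow> real \<Rightarrow> real" where
  "signed_powr s y = max y 0 powr s - max (- y) 0 powr s"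

lemma abs_signed_powr: "\<bar>signed_powr s y\<bar> = \<bar>y\<bar> powr s"
  by (auto simp: signed_powr_def max_def)

lemma signed_powr_1: "signed_powr 1 y = y"
  by (auto simp: signed_powr_def max_def)

lemma continuous_on_signed_powr [continuous_intros]:
  assumes "continuous_on S f" "0 < s"
  shows "continuous_on S (\<lambda>x. signed_powr s (f x))"
  unfolding signed_powr_def using assms by (intro continuous_intros continuous_on_powr') auto

lemma has_real_derivative_abs_powr:
  fixes s :: real
  assumes s: "1 < s"
  shows "((\<lambda>y. \<bar>y\<bar> powr s) has_real_derivative s * signed_powr (s - 1) y) (at y)"
proof -
  consider (pos) "0 < y" | (neg) "y < 0" | (zero) "y = 0" by linarith
  then show ?thesis
  proof cases
    case pos
    have "((\<lambda>y. y powr s) has_real_derivative s * signed_powr (s - 1) y) (at y)"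
      using pos by (auto intro!: derivative_eq_intros simp: signed_powr_def max_def)
    then show ?thesis
      by (rule has_field_derivative_transform_within_open[of _ _ _ "{0<..}"]) (use pos in auto)
  next
    case neg
    have "((\<lambda>y. (- y) powr s) has_real_derivative s * signed_powr (s - 1) y) (at y)"
      using neg by (auto intro!: derivative_eq_intros simp: signed_powr_def max_def)
    then show ?thesis
      by (rule has_field_derivative_transform_within_open[of _ _ _ "{..<0}"]) (use neg in auto)
  next
    case zero
    have "((\<lambda>h::real. \<bar>h\<bar> powr (s - 1)) \<longlongrightarrow> \<bar>0\<bar> powr (s - 1)) (at 0)"
      using s by (intro tendsto_powr' tendsto_intros) auto
    then have "((\<lambda>h::real. \<bar>h\<bar> powr (s - 1)) \<longlongrightarrow> 0) (at 0)"
      by simp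
    then have "((\<lambda>h::real. \<bar>h\<bar> powr s / h) \<longlongrightarrow> 0) (at 0)"
    proof (rule Lim_null_comparison[rotated], intro always_eventually allI)
      show "norm (\<bar>h\<bar> powr s / h) \<le> \<bar>h\<bar> powr (s - 1)" for h :: real
        by (cases "h = 0") (auto simp: powr_diff)
    qed
    then show ?thesis
      using zero by (simp add: DERIV_def signed_powr_def)
  qed
qed

lemma C1c_on_abs_powr:
  assumes f: "C1c_on S f G" and s: "1 < s"
  shows "C1c_on S (\<lambda>x. \<bar>f x\<bar> powr s) (\<lambda>x. (s * signed_powr (s - 1) (f x)) *\<^sub>R G x)"
proof -
  obtain K where K: "compact K" "K \<subseteq> S" "\<And>x. x \<notin> K \<Longrightarrow> f x = 0" "\<And>x. x \<notin> K \<Longrightarrow> G x = 0"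
    by (rule C1c_on_support[OF f]) blast
  have "((\<lambda>t. \<bar>f (x + t *\<^sub>R e)\<bar> powr s) has_real_derivative
      ((s * signed_powr (s - 1) (f x)) *\<^sub>R G x) \<bullet> e) (at 0)" if "e \<in> Basis" for x e
    using DERIV_chain2[OF has_real_derivative_abs_powr[OF s] C1c_on_has_real_derivative[OF f that]]
    by simp
  then show ?thesis
    unfolding C1c_on_def using K s
    by (auto intro!: continuous_intros continuous_on_powr' C1c_on_continuous[OF f] exI[of _ K])
qed

lemma has_real_derivative_norm_powr_line:
  fixes x e :: "'a::euclidean_space"
  assumes "x \<noteq> 0"
  shows "((\<lambda>t. norm (x + t *\<^sub>R e) powr r) has_real_derivative r * norm x powr (r - 2) * (x \<bullet> e)) (at 0)"
proof -
  have norm_powr: "norm y powr r = (y \<bullet> y) powr (r / 2)" for y :: 'a and r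
    by (cases "y = 0") (auto simp: power2_norm_eq_inner[symmetric] powr_powr simp flip: powr_numeral)
  have "((\<lambda>t. ((x + t *\<^sub>R e) \<bullet> (x + t *\<^sub>R e)) powr (r / 2)) has_real_derivative
      r * (x \<bullet> x) powr (r / 2 - 1) * (x \<bullet> e)) (at 0)"
    unfolding inner_add_left inner_add_right inner_scaleR_left inner_scaleR_right
    using assms by (auto intro!: derivative_eq_intros simp: inner_commute[of e x])
  moreover have "norm x powr (r - 2) = (x \<bullet> x) powr (r / 2 - 1)"
    using norm_powr[of x "r - 2"] by (simp add: diff_divide_distrib)
  ultimately show ?thesis by (simp add: norm_powr)
qed

lemma C1c_on_mult_norm_powr:
  fixes f :: "'a::euclidean_space \<Rightarrow> real"
  assumes f: "C1c_on (- {0}) f G"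
  shows "C1c_on (- {0}) (\<lambda>x. f x * norm x powr r)
    (\<lambda>x. norm x powr r *\<^sub>R G x + (r * norm x powr (r - 2) * f x) *\<^sub>R x)"
proof -
  obtain K where K: "compact K" "K \<subseteq> - {0}" "\<And>x. x \<notin> K \<Longrightarrow> f x = 0" "\<And>x. x \<notin> K \<Longrightarrow> G x = 0"
    by (rule C1c_on_support[OF f]) blast
  show ?thesis
  proof (rule C1c_onI_support[OF _ _ _ K(1,2)])
    show "continuous_on (- {0}) (\<lambda>x. f x * norm x powr r)"
      "continuous_on (- {0}) (\<lambda>x. norm x powr r *\<^sub>R G x + (r * norm x powr (r - 2) * f x) *\<^sub>R x)"
      by (auto intro!: continuous_intros C1c_on_continuous[OF f])
    show "((\<lambda>t. f (x + t *\<^sub>R e) * norm (x + t *\<^sub>R e) powr r) has_real_derivative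
        (norm x powr r *\<^sub>R G x + (r * norm x powr (r - 2) * f x) *\<^sub>R x) \<bullet> e) (at 0)"
      if "x \<in> - {0}" "e \<in> Basis" for x e
    proof -
      have "x \<noteq> 0" using that by simp
      from DERIV_mult[OF C1c_on_has_real_derivative[OF f that(2)] has_real_derivative_norm_powr_line[OF this]]
      show ?thesis by (simp add: inner_add_left algebra_simps)
    qed
  qed (use K in auto)
qed

lemma C1c_on_integrable_norm_powr:
  fixes f :: "'a::euclidean_space \<Rightarrow> real"
  assumes f: "C1c_on (- {0}) f G" and F: "continuous_on UNIV F" "\<And>x. f x = 0 \<Longrightarrow> G x = 0 \<Longrightarrow> F x = 0"
  shows "integrable lborel (\<lambda>x. F x * norm x powr r :: real)"
proof -
  obtain K where K: "compact K" "K \<subseteq> - {0}" "\<And>x. x \<notin> K \<Longrightarrow> f x = 0" "\<And>x. x \<notin> K \<Longrightarrow> G x = 0"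
    by (rule C1c_on_support[OF f]) blast
  have "continuous_on (- {0}) (\<lambda>x. F x * norm x powr r)"
    by (auto intro!: continuous_intros continuous_on_subset[OF F(1)])
  then have "continuous_on UNIV (\<lambda>x. F x * norm x powr r)"
    by (rule continuous_on_UNIV_if_compact_support[OF _ _ K(1,2), of _ 0]) (use K F in auto)
  then show ?thesis
    by (rule integrable_continuous_compact[OF _ K(1)]) (use K F in auto)
qed

subsection \<open>Integration along lines\<close>

lemma has_bochner_integral_line_FTC:
  fixes F D :: "'a::euclidean_space \<Rightarrow> real"
  assumes deriv: "\<And>x. ((\<lambda>t. F (x + t *\<^sub>R e)) has_real_derivative D x) (at 0)"
    and D: "continuous_on UNIV D" and "\<alpha> \<le> \<beta>"
  shows "has_bochner_integral lborel (\<lambda>t. D (x + t *\<^sub>R e) * indicator {\<alpha>..\<beta>} t)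
    (F (x + \<beta> *\<^sub>R e) - F (x + \<alpha> *\<^sub>R e))"
proof (rule has_bochner_integral_FTC_Icc_real[OF \<open>\<alpha> \<le> \<beta>\<close>])
  fix t
  have "((\<lambda>s. F (x + (s + t) *\<^sub>R e)) has_real_derivative D (x + t *\<^sub>R e)) (at 0)"
    using deriv[of "x + t *\<^sub>R e"] by (simp add: scaleR_add_left add_ac)
  then show "((\<lambda>t. F (x + t *\<^sub>R e)) has_real_derivative D (x + t *\<^sub>R e)) (at t)"
    by (subst DERIV_shift[where x = 0 and z = t, simplified])
  have "continuous_on UNIV (\<lambda>t. D (x + t *\<^sub>R e))"
    by (intro continuous_on_compose2[OF D] continuous_intros) auto
  then show "isCont (\<lambda>t. D (x + t *\<^sub>R e)) t"
    by (simp add: continuous_on_eq_continuous_at)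
qed

lemma integral_translate:
  fixes h :: "'a::euclidean_space \<Rightarrow> real"
  assumes [measurable]: "h \<in> borel_measurable borel"
  shows "(\<integral>x. h (x + c) \<partial>lborel) = (\<integral>x. h x \<partial>lborel)"
  using integral_distr[of "(+) c" lborel borel h] by (simp add: lborel_distr_plus add.commute)

lemma integrable_translates_unit_interval:
  fixes D :: "'a::euclidean_space \<Rightarrow> real"
  assumes D: "continuous_on UNIV D" and K: "compact K" "\<And>x. x \<notin> K \<Longrightarrow> D x = 0"
  shows "integrable (lborel \<Otimes>\<^sub>M lborel) (\<lambda>(s, x). D (x + s *\<^sub>R e) * indicator {0..1} s)"
proof -
  define L where "L = (\<lambda>(x, s). x - s *\<^sub>R e) ` (K \<times> {0..1})"
  have "compact L"
    unfolding L_def case_prod_beta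
    by (intro compact_continuous_image continuous_intros compact_Times K) auto
  then have "integrable lborel (\<lambda>z. indicator ({0..1} \<times> L) z *\<^sub>R D (snd z + fst z *\<^sub>R e))"
    by (intro borel_integrable_compact compact_Times continuous_intros continuous_on_compose2[OF D]) auto
  moreover have "D (x + s *\<^sub>R e) = 0" if "s \<in> {0..1}" "x \<notin> L" for s x
  proof (rule K(2), rule notI)
    assume "x + s *\<^sub>R e \<in> K"
    then have "x \<in> L"
      unfolding L_def using that(1) by (intro image_eqI[of _ _ "(x + s *\<^sub>R e, s)"]) auto
    then show False using that(2) by blast
  qed
  then have "(\<lambda>z. indicator ({0..1} \<times> L) z *\<^sub>R D (snd z + fst z *\<^sub>R e))
      = (\<lambda>(s, x). D (x + s *\<^sub>R e) * indicator {0..1} s)"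
    by (auto simp: fun_eq_iff indicator_def)
  ultimately show ?thesis
    by (simp only: lborel_prod)
qed

lemma integral_directional_derivative_eq_0:
  fixes F D :: "'a::euclidean_space \<Rightarrow> real"
  assumes F: "continuous_on UNIV F" and D: "continuous_on UNIV D" and K: "compact K"
    and zero: "\<And>x. x \<notin> K \<Longrightarrow> F x = 0" "\<And>x. x \<notin> K \<Longrightarrow> D x = 0"
    and deriv: "\<And>x. ((\<lambda>t. F (x + t *\<^sub>R e)) has_real_derivative D x) (at 0)"
  shows "(\<integral>x. D x \<partial>lborel) = 0"
proof -
  have [measurable]: "F \<in> borel_measurable borel" "D \<in> borel_measurable borel"
    using F D by (auto intro: borel_measurable_continuous_onI)
  have F_int: "integrable lborel F"
    by (rule integrable_continuous_compact[OF F K zero(1)])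
  then have F_shift_int: "integrable lborel (\<lambda>x. F (x + e))"
    using integrable_distr[of "(+) e" lborel borel F] by (simp add: lborel_distr_plus add.commute)
  have line: "(\<integral>s. D (x + s *\<^sub>R e) * indicator {0..1} s \<partial>lborel) = F (x + e) - F x" for x
    using has_bochner_integral_line_FTC[OF deriv D, of 0 1 x] by (simp add: has_bochner_integral_iff)
  have "(\<integral>x. D x \<partial>lborel) = (\<integral>s. (\<integral>x. D x \<partial>lborel) * indicator {0..1::real} s \<partial>lborel)"
    by simp
  also have "\<dots> = (\<integral>s. \<integral>x. D (x + s *\<^sub>R e) * indicator {0..1} s \<partial>lborel \<partial>lborel)"
    by (simp add: integral_translate)
  also have "\<dots> = (\<integral>x. \<integral>s. D (x + s *\<^sub>R e) * indicator {0..1} s \<partial>lborel \<partial>lborel)"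
    using lborel_pair.Fubini_integral[OF integrable_translates_unit_interval[OF D K zero(2)]] by simp
  also have "\<dots> = 0"
    using F_int F_shift_int by (simp add: line integral_translate)
  finally show ?thesis .
qed

lemma C1c_on_abs_le_line_int:
  fixes f :: "'a::euclidean_space \<Rightarrow> real"
  assumes f: "C1c_on S f G" and e: "e \<in> Basis"
  shows "ennreal \<bar>f x\<bar> \<le> line_int e (\<lambda>y. ennreal (norm (G y))) x"
proof -
  obtain K where K: "compact K" "\<And>x. x \<notin> K \<Longrightarrow> f x = 0"
    by (rule C1c_on_support[OF f]) blast
  obtain B where B: "\<And>x. x \<in> K \<Longrightarrow> norm x \<le> B"
    using K compact_imp_bounded bounded_iff by metis
  define R where "R = \<bar>B\<bar> + norm x + 1"
  have "0 \<le> R" by (simp add: R_def)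
  have "norm (x + (- R) *\<^sub>R e) = norm (R *\<^sub>R e - x)"
    by (simp add: norm_minus_commute)
  also have "\<dots> \<ge> R - norm x"
    using norm_triangle_ineq2[of "R *\<^sub>R e" x] e \<open>0 \<le> R\<close> by simp
  finally have "x + (- R) *\<^sub>R e \<notin> K"
    using B[of "x + (- R) *\<^sub>R e"] unfolding R_def by linarith
  then have f0: "f (x + (- R) *\<^sub>R e) = 0" by (rule K(2))
  have "continuous_on UNIV (\<lambda>y. G y \<bullet> e)" and "- R \<le> 0"
    using \<open>0 \<le> R\<close> by (auto intro!: continuous_intros C1c_on_continuous[OF f])
  then have FTC: "has_bochner_integral lborel (\<lambda>t. (G (x + t *\<^sub>R e) \<bullet> e) * indicator {-R..0} t) (f x)"
    using has_bochner_integral_line_FTC[OF C1c_on_has_real_derivative[OF f e], of "- R" 0 x] f0 by simp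
  then have "ennreal \<bar>f x\<bar> = ennreal (norm (\<integral>t. (G (x + t *\<^sub>R e) \<bullet> e) * indicator {-R..0} t \<partial>lborel))"
    by (simp add: has_bochner_integral_iff)
  also have "\<dots> \<le> (\<integral>\<^sup>+t. ennreal (norm ((G (x + t *\<^sub>R e) \<bullet> e) * indicator {-R..0} t)) \<partial>lborel)"
    using FTC by (intro integral_norm_bound_ennreal) (auto simp: has_bochner_integral_iff)
  also have "\<dots> \<le> line_int e (\<lambda>y. ennreal (norm (G y))) x"
    unfolding line_int_def
    by (intro nn_integral_mono ennreal_leI) (use e in \<open>auto simp: indicator_def Basis_le_norm\<close>)
  finally show ?thesis .
qed

lemma nn_integral_norm_grad:
  assumes "C1c_on S f G"
  shows "(\<integral>\<^sup>+x. ennreal (norm (G x)) \<partial>lborel) = ennreal (\<integral>x. norm (G x) \<partial>lborel)"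
  by (intro nn_integral_eq_integral C1c_on_integrable_grad[OF assms]) auto

lemma prod_mono_ennreal:
  fixes f g :: "'i \<Rightarrow> ennreal"
  shows "(\<And>i. i \<in> A \<Longrightarrow> f i \<le> g i) \<Longrightarrow> prod f A \<le> prod g A"
  by (induction A rule: infinite_finite_induct) (auto intro!: mult_mono)

theorem Gagliardo_Nirenberg:
  fixes f :: "'a::euclidean_space \<Rightarrow> real"
  assumes f: "C1c_on S f G" and d: "2 \<le> DIM('a)"
  defines "r \<equiv> real DIM('a) / (real DIM('a) - 1)"
  shows "(\<integral>x. \<bar>f x\<bar> powr r \<partial>lborel) \<le> (\<integral>x. norm (G x) \<partial>lborel) powr r"
proof -
  let ?m = "1 / (real DIM('a) - 1)"
  have [measurable]: "f \<in> borel_measurable borel" "G \<in> borel_measurable borel"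
    using C1c_on_measurable[OF f] .
  have epowr_power: "epowr (ennreal y) ?m ^ DIM('a) = ennreal (y powr r)" if "0 \<le> y" for y
    using that
    by (cases "y = 0") (auto simp: r_def epowr_ennreal ennreal_power powr_powr simp flip: powr_realpow)
  have "integrable lborel (\<lambda>x. \<bar>f x\<bar> powr r)"
    using d by (intro C1c_on_integrable[OF f])
      (auto simp: r_def intro!: continuous_intros continuous_on_powr' C1c_on_continuous[OF f])
  then have "ennreal (\<integral>x. \<bar>f x\<bar> powr r \<partial>lborel) = (\<integral>\<^sup>+x. ennreal (\<bar>f x\<bar> powr r) \<partial>lborel)"
    by (simp add: nn_integral_eq_integral)
  also have "\<dots> = (\<integral>\<^sup>+x. (\<Prod>i\<in>(Basis::'a set). epowr (ennreal \<bar>f x\<bar>) ?m) \<partial>lborel)"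
    by (simp add: epowr_power)
  also have "\<dots> \<le> (\<integral>\<^sup>+x. (\<Prod>i\<in>Basis. epowr (line_int i (\<lambda>y. ennreal (norm (G y))) x) ?m) \<partial>lborel)"
    by (intro nn_integral_mono prod_mono_ennreal epowr_mono C1c_on_abs_le_line_int[OF f])
      (use d in auto)
  also have "\<dots> \<le> epowr (\<integral>\<^sup>+x. ennreal (norm (G x)) \<partial>lborel) ?m ^ DIM('a)"
    by (rule Loomis_Whitney[OF _ d]) measurable
  also have "\<dots> = ennreal ((\<integral>x. norm (G x) \<partial>lborel) powr r)"
    by (simp add: nn_integral_norm_grad[OF f] epowr_power)
  finally show ?thesis by (simp add: ennreal_le_iff)
qed

lemma C1c_on_abs_le_integral_norm_grad_dim_1:
  fixes f :: "'a::euclidean_space \<Rightarrow> real"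
  assumes f: "C1c_on S f G" and d: "DIM('a) = 1"
  shows "\<bar>f x\<bar> \<le> (\<integral>x. norm (G x) \<partial>lborel)"
proof -
  obtain e where e: "(Basis :: 'a set) = {e}"
    using d card_1_singletonE by blast
  have [measurable]: "G \<in> borel_measurable borel"
    using C1c_on_measurable[OF f] by blast
  have "ennreal \<bar>f x\<bar> \<le> line_int e (\<lambda>y. ennreal (norm (G y))) x"
    by (rule C1c_on_abs_le_line_int[OF f]) (simp add: e)
  also have "\<dots> = partial_int Basis (\<lambda>y. ennreal (norm (G y))) x"
    by (simp add: e partial_int_singleton)
  also have "\<dots> = ennreal (\<integral>x. norm (G x) \<partial>lborel)"
    by (simp add: partial_int_Basis nn_integral_norm_grad[OF f])
  finally show ?thesis by (simp add: ennreal_le_iff)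
qed

subsection \<open>Weighted norms\<close>

definition wLp_integrable :: "real \<Rightarrow> real \<Rightarrow> ('a::euclidean_space \<Rightarrow> real) \<Rightarrow> bool" where
  "wLp_integrable b p u \<longleftrightarrow> u \<in> borel_measurable borel \<and>
     integrable lborel (\<lambda>x. \<bar>u x\<bar> powr p * norm x powr (-b*p))"

lemma wLp_nonneg: "0 \<le> wLp b p u"
  unfolding wLp_def by (intro integral_nonneg_AE) auto

lemma energy_nonneg: "0 \<le> energy a G"
  unfolding energy_def by (intro integral_nonneg_AE) auto

lemma C1c_on_wLp_integrable:
  assumes f: "C1c_on (- {0}) f G" and "0 < p"
  shows "wLp_integrable b p f"
  unfolding wLp_integrable_def using assms
  by (auto intro!: C1c_on_integrable_norm_powr[OF f] C1c_on_measurable[OF f] C1c_on_continuous[OF f]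
      continuous_intros continuous_on_powr')

lemma wLp_interpolation_le:
  assumes f0: "wLp_integrable b\<^sub>0 p\<^sub>0 f" and f1: "wLp_integrable b\<^sub>1 p\<^sub>1 f" and l: "0 \<le> l" "l \<le> 1"
    and p: "p = l * p\<^sub>0 + (1 - l) * p\<^sub>1" and b: "b * p = l * (b\<^sub>0 * p\<^sub>0) + (1 - l) * (b\<^sub>1 * p\<^sub>1)"
  shows "wLp b p f \<le> wLp b\<^sub>0 p\<^sub>0 f powr l * wLp b\<^sub>1 p\<^sub>1 f powr (1 - l)"
proof -
  have split: "(\<bar>f x\<bar> powr p\<^sub>0 * norm x powr (-b\<^sub>0*p\<^sub>0)) powr l
        * (\<bar>f x\<bar> powr p\<^sub>1 * norm x powr (-b\<^sub>1*p\<^sub>1)) powr (1 - l)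
      = \<bar>f x\<bar> powr p * norm x powr (-b*p)" for x
  proof -
    have "- b * p = - b\<^sub>0 * p\<^sub>0 * l + - b\<^sub>1 * p\<^sub>1 * (1 - l)"
      using b by (simp add: algebra_simps)
    moreover have "p = p\<^sub>0 * l + p\<^sub>1 * (1 - l)"
      using p by (simp add: algebra_simps)
    ultimately show ?thesis
      by (simp only: powr_mult powr_powr powr_add mult_ac)
  qed
  have int: "integrable lborel (\<lambda>x. \<bar>f x\<bar> powr p\<^sub>0 * norm x powr (-b\<^sub>0*p\<^sub>0))"
    "integrable lborel (\<lambda>x. \<bar>f x\<bar> powr p\<^sub>1 * norm x powr (-b\<^sub>1*p\<^sub>1))"
    using f0 f1 by (simp_all add: wLp_integrable_def)
  show "wLp b p f \<le> wLp b\<^sub>0 p\<^sub>0 f powr l * wLp b\<^sub>1 p\<^sub>1 f powr (1 - l)"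
    using Holder_integral_le[OF int _ _ l, unfolded split] by (simp add: wLp_def)
qed

lemma C1c_on_integral_powr_mult_grad:
  fixes f :: "'a::euclidean_space \<Rightarrow> real"
  assumes f: "C1c_on (- {0}) f G" and t: "0 < t" and b: "b * t = \<gamma> - a"
  shows C1c_on_integrable_powr_mult_grad:
      "integrable lborel (\<lambda>x. \<bar>f x\<bar> powr t * norm x powr - \<gamma> * norm (G x))"
    and C1c_on_integral_powr_mult_grad_le:
      "(\<integral>x. \<bar>f x\<bar> powr t * norm x powr - \<gamma> * norm (G x) \<partial>lborel)
        \<le> sqrt (energy a G) * sqrt (wLp b (2 * t) f)"
proof -
  have split: "((norm (G x))\<^sup>2 * norm x powr (-2*a)) powr (1/2)
      * (\<bar>f x\<bar> powr (2 * t) * norm x powr (-b*(2 * t))) powr (1 - 1/2)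
      = \<bar>f x\<bar> powr t * norm x powr - \<gamma> * norm (G x)" for x
  proof -
    have "- \<gamma> = - 2 * a * (1/2) + - b * (2 * t) * (1 - 1/2)"
      using b by (simp add: algebra_simps)
    then have "norm x powr - \<gamma> = (norm x powr (-2*a)) powr (1/2) * (norm x powr (-b*(2 * t))) powr (1 - 1/2)"
      by (simp only: powr_add powr_powr)
    then show ?thesis
      by (simp add: powr_mult powr_powr powr_half_sqrt)
  qed
  have int: "integrable lborel (\<lambda>x. (norm (G x))\<^sup>2 * norm x powr (-2*a))"
    "integrable lborel (\<lambda>x. \<bar>f x\<bar> powr (2 * t) * norm x powr (-b*(2 * t)))"
    using C1c_on_wLp_integrable[OF f, of "2 * t" b] t
    by (auto simp: wLp_integrable_def
        intro!: C1c_on_integrable_norm_powr[OF f] continuous_intros C1c_on_continuous[OF f])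
  show "integrable lborel (\<lambda>x. \<bar>f x\<bar> powr t * norm x powr - \<gamma> * norm (G x))"
    using Holder_integrable[OF int, of "1/2"] by (simp only: split) simp
  show "(\<integral>x. \<bar>f x\<bar> powr t * norm x powr - \<gamma> * norm (G x) \<partial>lborel) \<le> sqrt (energy a G) * sqrt (wLp b (2 * t) f)"
    using Holder_integral_le[OF int, of "1/2"]
    by (simp only: split) (simp add: energy_def wLp_def powr_half_sqrt)
qed

subsection \<open>The weighted Hardy inequality\<close>

lemma integral_radial_derivative:
  fixes f :: "'a::euclidean_space \<Rightarrow> real"
  assumes f: "C1c_on S f G"
  shows "(\<integral>x. G x \<bullet> x \<partial>lborel) = - real DIM('a) * (\<integral>x. f x \<partial>lborel)"
proof -
  obtain K where K: "compact K" "\<And>x. x \<notin> K \<Longrightarrow> f x = 0" "\<And>x. x \<notin> K \<Longrightarrow> G x = 0"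
    by (rule C1c_on_support[OF f]) blast
  have f_int: "integrable lborel f"
    by (rule C1c_on_integrable[OF f C1c_on_continuous(1)[OF f]])
  have G_int: "integrable lborel (\<lambda>x. (G x \<bullet> e) * (x \<bullet> e))" for e
    by (rule C1c_on_integrable[OF f]) (auto intro!: continuous_intros C1c_on_continuous[OF f])
  have "(\<integral>x. (G x \<bullet> e) * (x \<bullet> e) \<partial>lborel) = - (\<integral>x. f x \<partial>lborel)" if e: "e \<in> Basis" for e
  proof -
    have "(\<integral>x. (G x \<bullet> e) * (x \<bullet> e) + f x \<partial>lborel) = 0"
    proof (rule integral_directional_derivative_eq_0[where F = "\<lambda>x. f x * (x \<bullet> e)" and e = e])
      show "((\<lambda>t. f (x + t *\<^sub>R e) * ((x + t *\<^sub>R e) \<bullet> e)) has_real_derivative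
          (G x \<bullet> e) * (x \<bullet> e) + f x) (at 0)" for x
        using e by (auto intro!: derivative_eq_intros C1c_on_has_real_derivative[OF f] simp: inner_add_left)
    qed (use K in \<open>auto intro!: continuous_intros C1c_on_continuous[OF f]\<close>)
    then show ?thesis
      using f_int G_int[of e] by simp
  qed
  then have "(\<Sum>e\<in>Basis. \<integral>x. (G x \<bullet> e) * (x \<bullet> e) \<partial>lborel) = - real DIM('a) * (\<integral>x. f x \<partial>lborel)"
    by simp
  then show ?thesis
    using G_int by (subst euclidean_inner) (simp add: Bochner_Integration.integral_sum)
qed

lemma integral_radial_derivative_norm_powr:
  fixes f :: "'a::euclidean_space \<Rightarrow> real"
  assumes f: "C1c_on (- {0}) f G"
  shows "(\<integral>x. (G x \<bullet> x) * norm x powr r \<partial>lborel) = - (real DIM('a) + r) * (\<integral>x. f x * norm x powr r \<partial>lborel)"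
proof -
  have f_int: "integrable lborel (\<lambda>x. f x * norm x powr r)"
    by (rule C1c_on_integrable_norm_powr[OF f C1c_on_continuous(1)[OF f]])
  have G_int: "integrable lborel (\<lambda>x. (G x \<bullet> x) * norm x powr r)"
    by (rule C1c_on_integrable_norm_powr[OF f]) (auto intro!: continuous_intros C1c_on_continuous[OF f])
  have radial: "(norm x powr r *\<^sub>R G x + (r * norm x powr (r - 2) * f x) *\<^sub>R x) \<bullet> x
      = (G x \<bullet> x) * norm x powr r + r * (f x * norm x powr r)" for x
    by (cases "x = 0") (simp_all add: inner_add_left powr_diff power2_norm_eq_inner[symmetric])
  show ?thesis
    using integral_radial_derivative[OF C1c_on_mult_norm_powr[OF f, of r], unfolded radial] f_int G_int
    by (simp add: algebra_simps)
qed

definition Hardy_const :: "'a::euclidean_space itself \<Rightarrow> real \<Rightarrow> real" where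
  "Hardy_const _ a = 2 / (real DIM('a) - 2 - 2 * a)"

lemma Hardy_const_pos: "2 * a + 2 < real DIM('a::euclidean_space) \<Longrightarrow> 0 < Hardy_const TYPE('a) a"
  by (simp add: Hardy_const_def)

lemma wLp_2_le_integral_mult_grad:
  fixes f :: "'a::euclidean_space \<Rightarrow> real"
  assumes f: "C1c_on (- {0}) f G"
  shows "(real DIM('a) - 2 - 2 * a) * wLp (a + 1) 2 f
    \<le> 2 * (\<integral>x. \<bar>f x\<bar> * norm x powr - (2 * a + 1) * norm (G x) \<partial>lborel)"
proof -
  let ?J = "\<lambda>x. \<bar>f x\<bar> * norm x powr - (2 * a + 1) * norm (G x)"
  have "(real DIM('a) - 2 - 2 * a) * wLp (a + 1) 2 f
      = - (\<integral>x. 2 * f x * (G x \<bullet> x) * norm x powr (-(a + 1)*2) \<partial>lborel)"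
    using integral_radial_derivative_norm_powr[OF C1c_on_abs_powr[OF f, of 2], of "-(a + 1)*2"]
    by (simp add: wLp_def signed_powr_1 algebra_simps)
  also have "\<dots> \<le> (\<integral>x. \<bar>2 * f x * (G x \<bullet> x) * norm x powr (-(a + 1)*2)\<bar> \<partial>lborel)"
    using integral_abs_bound[of lborel "\<lambda>x. 2 * f x * (G x \<bullet> x) * norm x powr (-(a + 1)*2)"]
    by linarith
  also have "\<dots> \<le> (\<integral>x. 2 * ?J x \<partial>lborel)"
  proof (rule integral_mono)
    show "integrable lborel (\<lambda>x. \<bar>2 * f x * (G x \<bullet> x) * norm x powr (-(a + 1)*2)\<bar>)"
      by (intro integrable_abs C1c_on_integrable_norm_powr[OF f])
        (auto intro!: continuous_intros C1c_on_continuous[OF f])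
    show "integrable lborel (\<lambda>x. 2 * ?J x)"
      using C1c_on_integrable_powr_mult_grad[OF f, of 1 "a + 1" "2 * a + 1" a] by simp
    fix x
    have "\<bar>2 * f x * (G x \<bullet> x) * norm x powr (-(a + 1)*2)\<bar>
        \<le> 2 * \<bar>f x\<bar> * (norm (G x) * norm x) * norm x powr (-(a + 1)*2)"
      by (simp add: abs_mult mult_left_mono mult_right_mono Cauchy_Schwarz_ineq2)
    also have "\<dots> = 2 * \<bar>f x\<bar> * norm (G x) * (norm x * norm x powr (-(a + 1)*2))"
      by simp
    also have "norm x * norm x powr (-(a + 1)*2) = norm x powr (1 + -(a + 1)*2)"
      by (simp only: powr_mult_base norm_ge_zero)
    also have "2 * \<bar>f x\<bar> * norm (G x) * \<dots> = 2 * ?J x"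
      by (simp add: algebra_simps)
    finally show "\<bar>2 * f x * (G x \<bullet> x) * norm x powr (-(a + 1)*2)\<bar> \<le> 2 * ?J x" .
  qed
  finally show ?thesis by simp
qed

theorem Hardy:
  fixes f :: "'a::euclidean_space \<Rightarrow> real"
  assumes f: "C1c_on (- {0}) f G" and a: "2 * a + 2 < real DIM('a)"
  shows "sqrt (wLp (a + 1) 2 f) \<le> Hardy_const TYPE('a) a * sqrt (energy a G)"
proof -
  define N where "N = wLp (a + 1) 2 f"
  define \<delta> where "\<delta> = real DIM('a) - 2 - 2 * a"
  have "\<delta> * N \<le> 2 * (sqrt (energy a G) * sqrt N)"
    using wLp_2_le_integral_mult_grad[OF f, of a]
      C1c_on_integral_powr_mult_grad_le[OF f, of 1 "a + 1" "2 * a + 1" a]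
    by (simp add: N_def \<delta>_def)
  moreover have "N = sqrt N * sqrt N" "0 \<le> sqrt N"
    by (simp_all add: N_def wLp_nonneg)
  ultimately have "(\<delta> * sqrt N) * sqrt N \<le> (2 * sqrt (energy a G)) * sqrt N"
    by (simp add: mult.assoc)
  then have "\<delta> * sqrt N \<le> 2 * sqrt (energy a G)"
    using \<open>0 \<le> sqrt N\<close> energy_nonneg[of a G] by (cases "sqrt N = 0") (auto simp: mult_le_cancel_right)
  then show ?thesis
    using a by (simp add: Hardy_const_def N_def \<delta>_def field_simps)
qed

subsection \<open>The Caffarelli-Kohn-Nirenberg inequality\<close>

lemma wLp_le_Hardy_mult:
  fixes f :: "'a::euclidean_space \<Rightarrow> real"
  assumes f: "C1c_on (- {0}) f G" and a: "2 * a + 2 < real DIM('a)" and s: "1 < s"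
    and c: "c * s = a + 1 + b * (s - 1)"
  shows "wLp c s f \<le> Hardy_const TYPE('a) a * sqrt (energy a G) * sqrt (wLp b (2 * (s - 1)) f)"
proof -
  have f_int: "wLp_integrable (a + 1) 2 f" "wLp_integrable b (2 * (s - 1)) f"
    using s by (auto intro: C1c_on_wLp_integrable[OF f])
  have "s = 1/2 * 2 + (1 - 1/2) * (2 * (s - 1))"
    "c * s = 1/2 * ((a + 1) * 2) + (1 - 1/2) * (b * (2 * (s - 1)))"
    using c by (simp_all add: field_simps)
  from wLp_interpolation_le[OF f_int _ _ this]
  have "wLp c s f \<le> sqrt (wLp (a + 1) 2 f) * sqrt (wLp b (2 * (s - 1)) f)"
    by (simp add: powr_half_sqrt wLp_nonneg)
  also have "\<dots> \<le> Hardy_const TYPE('a) a * sqrt (energy a G) * sqrt (wLp b (2 * (s - 1)) f)"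
    by (intro mult_right_mono Hardy f a) (simp add: wLp_nonneg)
  finally show ?thesis .
qed

lemma C1c_on_weighted_power_grad_le:
  fixes f :: "'a::euclidean_space \<Rightarrow> real"
  assumes f: "C1c_on (- {0}) f G" and a: "2 * a + 2 < real DIM('a)" and s: "1 < s"
    and b: "b * (s - 1) = \<gamma> - a"
  obtains H where "C1c_on (- {0}) (\<lambda>x. \<bar>f x\<bar> powr s * norm x powr - \<gamma>) H"
    and "(\<integral>x. norm (H x) \<partial>lborel) \<le> (s + \<bar>\<gamma>\<bar> * Hardy_const TYPE('a) a)
      * (sqrt (energy a G) * sqrt (wLp b (2 * (s - 1)) f))"
proof
  let ?k = "Hardy_const TYPE('a) a" and ?E = "sqrt (energy a G)" and ?N = "sqrt (wLp b (2 * (s - 1)) f)"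
  define H where "H x = norm x powr - \<gamma> *\<^sub>R ((s * signed_powr (s - 1) (f x)) *\<^sub>R G x)
    + (- \<gamma> * norm x powr (- \<gamma> - 2) * \<bar>f x\<bar> powr s) *\<^sub>R x" for x
  define A where "A x = \<bar>f x\<bar> powr (s - 1) * norm x powr - \<gamma> * norm (G x)" for x
  define c where "c = (\<gamma> + 1) / s"
  define B where "B x = \<bar>f x\<bar> powr s * norm x powr (- c * s)" for x
  have c: "c * s = \<gamma> + 1" using s by (simp add: c_def)
  show H: "C1c_on (- {0}) (\<lambda>x. \<bar>f x\<bar> powr s * norm x powr - \<gamma>) H"
    using C1c_on_mult_norm_powr[OF C1c_on_abs_powr[OF f s], of "- \<gamma>"] by (simp only: H_def[abs_def])
  have A: "integrable lborel A" "(\<integral>x. A x \<partial>lborel) \<le> ?E * ?N"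
    using C1c_on_integral_powr_mult_grad[OF f _ b] s by (auto simp: A_def[abs_def])
  have B: "integrable lborel B" "(\<integral>x. B x \<partial>lborel) \<le> (?k * ?E) * ?N"
  proof -
    show "integrable lborel B"
      using C1c_on_wLp_integrable[OF f, of s c] s by (simp add: wLp_integrable_def B_def[abs_def])
    have weight: "c * s = a + 1 + b * (s - 1)" using b c by simp
    show "(\<integral>x. B x \<partial>lborel) \<le> (?k * ?E) * ?N"
      using wLp_le_Hardy_mult[OF f a s weight] by (simp add: wLp_def[of c] B_def)
  qed
  have "(\<integral>x. norm (H x) \<partial>lborel) \<le> (\<integral>x. s * A x + \<bar>\<gamma>\<bar> * B x \<partial>lborel)"
  proof (rule integral_mono)
    fix x :: 'a
    have "- c * s = 1 + (- \<gamma> - 2)" using c by simp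
    then have "norm x powr (- c * s) = norm x * norm x powr (- \<gamma> - 2)"
      by (simp only: powr_mult_base norm_ge_zero)
    then show "norm (H x) \<le> s * A x + \<bar>\<gamma>\<bar> * B x"
      unfolding H_def using s
      by (intro order_trans[OF norm_triangle_ineq]) (simp add: A_def B_def abs_mult abs_signed_powr)
  qed (use C1c_on_integrable_grad[OF H] A B in auto)
  also have "\<dots> = s * (\<integral>x. A x \<partial>lborel) + \<bar>\<gamma>\<bar> * (\<integral>x. B x \<partial>lborel)"
    using A B by simp
  also have "\<dots> \<le> s * (?E * ?N) + \<bar>\<gamma>\<bar> * ((?k * ?E) * ?N)"
    using s A(2) B(2) by (intro add_mono mult_left_mono) auto
  finally show "(\<integral>x. norm (H x) \<partial>lborel) \<le> (s + \<bar>\<gamma>\<bar> * ?k) * (?E * ?N)"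
    by (simp add: algebra_simps)
qed

definition CKN_bound :: "'a::euclidean_space itself \<Rightarrow> real \<Rightarrow> real \<Rightarrow> real \<Rightarrow> real \<Rightarrow> bool" where
  "CKN_bound _ a b p C \<longleftrightarrow>
     (\<forall>(f :: 'a \<Rightarrow> real) G. C1c_on (- {0}) f G \<longrightarrow> wLp b p f \<le> C * energy a G powr (p / 2))"

lemma CKN_bound_Hardy:
  assumes a: "2 * a + 2 < real DIM('a::euclidean_space)"
  shows "CKN_bound TYPE('a) a (a + 1) 2 ((Hardy_const TYPE('a) a)\<^sup>2)"
proof -
  have "wLp (a + 1) 2 f \<le> (Hardy_const TYPE('a) a)\<^sup>2 * energy a G"
    if "C1c_on (- {0}) f G" for f :: "'a \<Rightarrow> real" and G
    using power_mono[OF Hardy[OF that a], of 2] by (simp add: wLp_nonneg energy_nonneg power_mult_distrib)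
  then show ?thesis
    by (simp add: CKN_bound_def energy_nonneg)
qed

lemma CKN_bound_interpolation:
  assumes C\<^sub>0: "CKN_bound TYPE('a::euclidean_space) a b\<^sub>0 p\<^sub>0 C\<^sub>0" and C\<^sub>1: "CKN_bound TYPE('a) a b\<^sub>1 p\<^sub>1 C\<^sub>1"
    and p01: "0 < p\<^sub>0" "0 < p\<^sub>1" and l: "0 \<le> l" "l \<le> 1"
    and p: "p = l * p\<^sub>0 + (1 - l) * p\<^sub>1" and b: "b * p = l * (b\<^sub>0 * p\<^sub>0) + (1 - l) * (b\<^sub>1 * p\<^sub>1)"
  shows "CKN_bound TYPE('a) a b p (C\<^sub>0 powr l * C\<^sub>1 powr (1 - l))"
  unfolding CKN_bound_def
proof (intro allI impI)
  fix f :: "'a \<Rightarrow> real" and G assume f: "C1c_on (- {0}) f G"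
  let ?E = "energy a G"
  have "wLp b p f \<le> wLp b\<^sub>0 p\<^sub>0 f powr l * wLp b\<^sub>1 p\<^sub>1 f powr (1 - l)"
    by (rule wLp_interpolation_le[OF _ _ l p b]) (auto intro: C1c_on_wLp_integrable[OF f] p01)
  also have "\<dots> \<le> (C\<^sub>0 * ?E powr (p\<^sub>0 / 2)) powr l * (C\<^sub>1 * ?E powr (p\<^sub>1 / 2)) powr (1 - l)"
    using C\<^sub>0 C\<^sub>1 f l by (intro mult_mono powr_mono2 wLp_nonneg) (auto simp: CKN_bound_def)
  also have "\<dots> = C\<^sub>0 powr l * C\<^sub>1 powr (1 - l) * ?E powr (p\<^sub>0 / 2 * l + p\<^sub>1 / 2 * (1 - l))"
    by (simp only: powr_mult powr_powr powr_add mult_ac)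
  also have "p\<^sub>0 / 2 * l + p\<^sub>1 / 2 * (1 - l) = p / 2"
    by (simp add: p field_simps)
  finally show "wLp b p f \<le> C\<^sub>0 powr l * C\<^sub>1 powr (1 - l) * ?E powr (p / 2)" .
qed

lemma wLp_le_powr_energy_mult_wLp:
  fixes f :: "'a::euclidean_space \<Rightarrow> real"
  assumes f: "C1c_on (- {0}) f G" and a: "2 * a + 2 < real DIM('a)" and d: "2 \<le> DIM('a)" and s: "1 < s"
    and b': "b' * (s - 1) = s * b - a"
  defines "r \<equiv> real DIM('a) / (real DIM('a) - 1)"
  shows "wLp b (s * r) f \<le> ((s + \<bar>s * b\<bar> * Hardy_const TYPE('a) a)
    * (sqrt (energy a G) * sqrt (wLp b' (2 * (s - 1)) f))) powr r"
proof -
  obtain H where H: "C1c_on (- {0}) (\<lambda>x. \<bar>f x\<bar> powr s * norm x powr - (s * b)) H"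
    and H_le: "(\<integral>x. norm (H x) \<partial>lborel) \<le> (s + \<bar>s * b\<bar> * Hardy_const TYPE('a) a)
      * (sqrt (energy a G) * sqrt (wLp b' (2 * (s - 1)) f))"
    by (rule C1c_on_weighted_power_grad_le[OF f a s b'])
  have "wLp b (s * r) f = (\<integral>x. \<bar>\<bar>f x\<bar> powr s * norm x powr - (s * b)\<bar> powr r \<partial>lborel)"
    by (simp add: wLp_def powr_mult powr_powr mult_ac)
  also have "\<dots> \<le> (\<integral>x. norm (H x) \<partial>lborel) powr r"
    using Gagliardo_Nirenberg[OF H d] unfolding r_def .
  also have "\<dots> \<le> ((s + \<bar>s * b\<bar> * Hardy_const TYPE('a) a)
      * (sqrt (energy a G) * sqrt (wLp b' (2 * (s - 1)) f))) powr r"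
    using H_le d by (intro powr_mono2) (auto simp: r_def intro!: integral_nonneg_AE)
  finally show ?thesis .
qed

text \<open>The relation under which both sides of the inequality scale alike under dilations.\<close>
definition CKN_scaling :: "'a::euclidean_space itself \<Rightarrow> real \<Rightarrow> real \<Rightarrow> real \<Rightarrow> bool" where
  "CKN_scaling _ a b p \<longleftrightarrow> b * p = (a - (real DIM('a) - 2) / 2) * p + real DIM('a)"

lemma CKN_scaling_Hardy: "CKN_scaling TYPE('a::euclidean_space) a (a + 1) 2"
  by (simp add: CKN_scaling_def field_simps)

lemma CKN_scaling_interpolation:
  assumes "CKN_scaling TYPE('a::euclidean_space) a b\<^sub>0 p\<^sub>0" "CKN_scaling TYPE('a) a b\<^sub>1 p\<^sub>1"
    and "CKN_scaling TYPE('a) a b p" and "p = l * p\<^sub>0 + (1 - l) * p\<^sub>1"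
  shows "b * p = l * (b\<^sub>0 * p\<^sub>0) + (1 - l) * (b\<^sub>1 * p\<^sub>1)"
  unfolding assms(1-3)[unfolded CKN_scaling_def] unfolding assms(4) by (simp add: field_simps)

lemma wLp_le_mult_powr_self:
  assumes a: "2 * a + 2 < real DIM('a::euclidean_space)" and d: "2 \<le> DIM('a)" and s: "1 < s"
    and l: "0 \<le> l" "l \<le> 1" and b': "b' * (s - 1) = s * b - a"
  defines "r \<equiv> real DIM('a) / (real DIM('a) - 1)"
  assumes interpolation: "2 * (s - 1) = l * (s * r) + (1 - l) * 2"
    "b' * (2 * (s - 1)) = l * (b * (s * r)) + (1 - l) * ((a + 1) * 2)"
  obtains C where "\<And>(f :: 'a \<Rightarrow> real) G. C1c_on (- {0}) f G \<Longrightarrow>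
    wLp b (s * r) f \<le> C * energy a G powr (r * (2 - l) / 2) * wLp b (s * r) f powr (l * r / 2)"
proof
  define k where "k = Hardy_const TYPE('a) a"
  define K where "K = s + \<bar>s * b\<bar> * k"
  have K: "0 \<le> K"
    using Hardy_const_pos[OF a] s by (simp add: k_def K_def)
  have r: "0 < r" using d by (simp add: r_def)
  fix f :: "'a \<Rightarrow> real" and G assume f: "C1c_on (- {0}) f G"
  let ?E = "energy a G" and ?N = "wLp b (s * r) f"
  have "wLp b' (2 * (s - 1)) f \<le> ?N powr l * wLp (a + 1) 2 f powr (1 - l)"
    by (rule wLp_interpolation_le[OF _ _ l interpolation])
      (use s r in \<open>auto intro: C1c_on_wLp_integrable[OF f]\<close>)
  also have "\<dots> \<le> ?N powr l * (k\<^sup>2 * ?E) powr (1 - l)"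
    using CKN_bound_Hardy[OF a] f l
    by (intro mult_left_mono powr_mono2 wLp_nonneg) (auto simp: CKN_bound_def k_def energy_nonneg)
  finally have interpolated: "wLp b' (2 * (s - 1)) f \<le> ?N powr l * (k\<^sup>2 * ?E) powr (1 - l)" .
  have "?N \<le> (K * (sqrt ?E * sqrt (wLp b' (2 * (s - 1)) f))) powr r"
    using wLp_le_powr_energy_mult_wLp[OF f a d s b'] by (simp add: r_def K_def k_def)
  also have "\<dots> \<le> (K * (sqrt ?E * sqrt (?N powr l * (k\<^sup>2 * ?E) powr (1 - l)))) powr r"
    using K r interpolated
    by (intro powr_mono2 mult_left_mono real_sqrt_le_mono) (auto simp: energy_nonneg wLp_nonneg)
  also have "\<dots> = K powr r * (k\<^sup>2) powr ((1 - l) * r / 2)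
      * ?E powr (1/2 * r + (1 - l) * (1/2) * r) * ?N powr (l * r / 2)"
    by (simp add: powr_mult powr_powr powr_add energy_nonneg flip: powr_half_sqrt)
  also have "1/2 * r + (1 - l) * (1/2) * r = r * (2 - l) / 2"
    by (simp add: field_simps)
  finally show "?N \<le> K powr r * (k\<^sup>2) powr ((1 - l) * r / 2)
      * ?E powr (r * (2 - l) / 2) * ?N powr (l * r / 2)" .
qed

lemma le_powr_if_le_mult_powr_self:
  fixes x :: real
  assumes x: "0 \<le> x" "x \<le> A * x powr \<theta>" and \<theta>: "\<theta> < 1"
  shows "x \<le> A powr (1 / (1 - \<theta>))"
proof (cases "x = 0")
  case False
  then have "x powr (1 - \<theta>) \<le> A"
    using x by (simp add: powr_diff pos_divide_le_eq)
  then have "(x powr (1 - \<theta>)) powr (1 / (1 - \<theta>)) \<le> A powr (1 / (1 - \<theta>))"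
    using \<theta> by (intro powr_mono2) auto
  then show ?thesis
    using x(1) \<theta> by (simp add: powr_powr)
qed simp

lemma CKN_bound_if_interpolated:
  assumes a: "2 * a + 2 < real DIM('a::euclidean_space)" and d: "2 \<le> DIM('a)" and s: "1 < s"
    and l: "0 \<le> l" "l \<le> 1" and b': "b' * (s - 1) = s * b - a"
  defines "r \<equiv> real DIM('a) / (real DIM('a) - 1)"
  assumes interpolation: "2 * (s - 1) = l * (s * r) + (1 - l) * 2"
    "b' * (2 * (s - 1)) = l * (b * (s * r)) + (1 - l) * ((a + 1) * 2)"
    and lr: "l * r < 2"
  shows "\<exists>C. CKN_bound TYPE('a) a b (s * r) C"
proof -
  obtain C where C: "\<And>(f :: 'a \<Rightarrow> real) G. C1c_on (- {0}) f G \<Longrightarrow>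
      wLp b (s * r) f \<le> C * energy a G powr (r * (2 - l) / 2) * wLp b (s * r) f powr (l * r / 2)"
    by (rule wLp_le_mult_powr_self[OF a d s l b' interpolation[unfolded r_def], folded r_def], rule that)
  define e where "e = 1 / (1 - l * r / 2)"
  have "(s * r) * (1 - l * r / 2) = s * r - r / 2 * (l * (s * r))"
    by (simp add: algebra_simps)
  also have "l * (s * r) = 2 * s - 4 + 2 * l"
    using interpolation(1) by (simp add: algebra_simps)
  also have "s * r - r / 2 * (2 * s - 4 + 2 * l) = r * (2 - l)"
    by (simp add: field_simps)
  finally have exponent: "r * (2 - l) / 2 * e = (s * r) / 2"
    using lr by (simp add: e_def field_simps)
  have "wLp b (s * r) f \<le> C powr e * energy a G powr ((s * r) / 2)"
    if f: "C1c_on (- {0}) f G" for f :: "'a \<Rightarrow> real" and G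
  proof -
    have "wLp b (s * r) f \<le> (C * energy a G powr (r * (2 - l) / 2)) powr e"
      unfolding e_def using C[OF f] lr by (intro le_powr_if_le_mult_powr_self wLp_nonneg) auto
    then show ?thesis
      by (simp only: powr_mult powr_powr exponent)
  qed
  then show ?thesis
    unfolding CKN_bound_def by blast
qed

lemma CKN_scaling_weighted_power:
  assumes b: "CKN_scaling TYPE('a::euclidean_space) a b (s * (real DIM('a) / (real DIM('a) - 1)))"
    and d: "2 \<le> DIM('a)" and b': "b' * (s - 1) = s * b - a"
  shows "CKN_scaling TYPE('a) a b' (2 * (s - 1))"
proof -
  define D where "D = real DIM('a)"
  define r where "r = D / (D - 1)"
  have r: "0 < r" "r * (D - 1) = D" using d by (simp_all add: r_def D_def)
  have "(s * b) * r = (a - (D - 2) / 2) * (s * r) + r * (D - 1)"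
    using b r(2) by (simp add: CKN_scaling_def D_def r_def mult_ac)
  also have "\<dots> = ((a - (D - 2) / 2) * s + (D - 1)) * r"
    by (simp add: algebra_simps)
  finally have "s * b = (a - (D - 2) / 2) * s + (D - 1)"
    using r by simp
  with b' show ?thesis
    unfolding CKN_scaling_def D_def[symmetric] by (simp add: field_simps)
qed

lemma CKN_bound_large_exponent:
  assumes a: "2 * a + 2 < real DIM('a::euclidean_space)" and d: "2 \<le> DIM('a)"
    and p_ge: "2 * (real DIM('a) / (real DIM('a) - 1)) \<le> p"
    and p_le: "(real DIM('a) - 2) * p \<le> 2 * real DIM('a)"
    and b: "CKN_scaling TYPE('a) a b p"
  shows "\<exists>C. CKN_bound TYPE('a) a b p C"
proof -
  define D where "D = real DIM('a)"
  define r where "r = D / (D - 1)"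
  define s where "s = p / r"
  define l where "l = (2 * s - 4) / (p - 2)"
  define b' where "b' = (s * b - a) / (s - 1)"
  have D: "2 \<le> D" using d by (simp add: D_def)
  have r: "1 < r" "r * (D - 1) = D" using D by (simp_all add: r_def)
  have s: "2 \<le> s" "s * r = p"
    using p_ge r unfolding D_def[symmetric] r_def[symmetric] by (simp_all add: s_def pos_le_divide_eq)
  have "2 * 1 < s * r"
    using s r by (intro mult_le_less_imp_less) auto
  then have p: "2 < p" using s by simp
  have "s * D = p * (D - 1)"
    using r s by (metis mult.assoc mult.commute)
  then have "(2 * s - 4) * D \<le> (p - 2) * D"
    using p_le unfolding D_def[symmetric] by (simp add: algebra_simps)
  then have l: "0 \<le> l" "l \<le> 1" "l * (p - 2) = 2 * s - 4"
    using s p D by (auto simp: l_def)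
  have "l * r * (p - 2) = r * (2 * s - 4)"
    using l(3) by (simp add: mult_ac)
  also have "\<dots> < 2 * (p - 2)"
    using s r by (simp add: algebra_simps)
  finally have lr: "l * r < 2"
    using p by (simp only: mult_less_cancel_right_pos)
  have b': "b' * (s - 1) = s * b - a"
    using s by (simp add: b'_def)
  have p_interpolation: "2 * (s - 1) = l * p + (1 - l) * 2"
    using l(3) by (simp add: algebra_simps)
  have "CKN_scaling TYPE('a) a b' (2 * (s - 1))"
    using CKN_scaling_weighted_power[OF _ d b'] b s(2) by (simp add: D_def r_def)
  note b_interpolation = CKN_scaling_interpolation[OF b CKN_scaling_Hardy this p_interpolation]
  show ?thesis
    using CKN_bound_if_interpolated[OF a d _ l(1,2) b'] s p_interpolation b_interpolation lr
    unfolding D_def[symmetric] r_def[symmetric] by simp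
qed

lemma CKN_bound_dim_ge_2:
  assumes a: "2 * a + 2 < real DIM('a::euclidean_space)" and d: "2 \<le> DIM('a)"
    and p: "2 \<le> p" "(real DIM('a) - 2) * p \<le> 2 * real DIM('a)" and b: "CKN_scaling TYPE('a) a b p"
  shows "\<exists>C. CKN_bound TYPE('a) a b p C"
proof -
  define D where "D = real DIM('a)"
  define P where "P = 2 * (D / (D - 1))"
  have D: "2 \<le> D" using d by (simp add: D_def)
  show ?thesis
  proof (cases "P \<le> p")
    case True
    then show ?thesis
      using CKN_bound_large_exponent[OF a d _ p(2) b] by (simp add: P_def D_def)
  next
    case False
    define B where "B = ((a - (D - 2) / 2) * P + D) / P"
    define l where "l = (p - 2) / (P - 2)"
    have P: "2 < P" "(D - 2) * P \<le> 2 * D"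
      using D by (simp_all add: P_def field_simps)
    have B: "CKN_scaling TYPE('a) a B P"
      using P by (simp add: CKN_scaling_def B_def D_def)
    obtain C where C: "CKN_bound TYPE('a) a B P C"
      using CKN_bound_large_exponent[OF a d _ _ B] P by (auto simp: P_def D_def)
    have l: "0 \<le> l" "l \<le> 1" using False p P by (simp_all add: l_def)
    have "l * (P - 2) = p - 2" using P by (simp add: l_def)
    then have p_interpolation: "p = l * P + (1 - l) * 2" by (simp add: algebra_simps)
    show ?thesis
      using CKN_bound_interpolation[OF C CKN_bound_Hardy[OF a] _ _ l p_interpolation
          CKN_scaling_interpolation[OF B CKN_scaling_Hardy b p_interpolation]] P by auto
  qed
qed

lemma wLp_le_if_bounded:
  fixes f :: "'a::euclidean_space \<Rightarrow> real"
  assumes f: "wLp_integrable c m f" and bound: "\<And>x. \<bar>f x\<bar> powr t * norm x powr - \<gamma> \<le> M" and e: "0 \<le> e"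
    and p: "p = t * e + m" and b: "b * p = \<gamma> * e + c * m"
  shows "wLp b p f \<le> M powr e * wLp c m f"
proof -
  have "wLp b p f \<le> (\<integral>x. M powr e * (\<bar>f x\<bar> powr m * norm x powr (-c*m)) \<partial>lborel)"
    unfolding wLp_def
  proof (rule integral_mono')
    fix x
    have "- b * p = - \<gamma> * e + - c * m" using b by simp
    then have "\<bar>f x\<bar> powr p * norm x powr (-b*p)
        = (\<bar>f x\<bar> powr t * norm x powr - \<gamma>) powr e * (\<bar>f x\<bar> powr m * norm x powr (-c*m))"
      by (simp only: p powr_add powr_mult powr_powr mult_ac)
    also have "\<dots> \<le> M powr e * (\<bar>f x\<bar> powr m * norm x powr (-c*m))"
      using e bound by (intro mult_right_mono powr_mono2) auto
    finally show "\<bar>f x\<bar> powr p * norm x powr (-b*p) \<le> M powr e * (\<bar>f x\<bar> powr m * norm x powr (-c*m))" .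
  qed (use f in \<open>auto simp: wLp_integrable_def\<close>)
  then show ?thesis by (simp add: wLp_def)
qed

lemma CKN_bound_dim_1:
  assumes a: "2 * a + 2 < real DIM('a::euclidean_space)" and d: "DIM('a) = 1"
    and p: "2 \<le> p" and b: "CKN_scaling TYPE('a) a b p"
  shows "\<exists>C. CKN_bound TYPE('a) a b p C"
proof -
  define k where "k = Hardy_const TYPE('a) a"
  define K where "K = (2 + \<bar>2 * a + 1\<bar> * k) * k"
  have k: "0 < k" using Hardy_const_pos[OF a] by (simp add: k_def)
  have "wLp b p f \<le> K powr ((p - 2) / 2) * k\<^sup>2 * energy a G powr (p / 2)"
    if f: "C1c_on (- {0}) f G" for f :: "'a \<Rightarrow> real" and G
  proof -
    let ?E = "energy a G"
    obtain H where H: "C1c_on (- {0}) (\<lambda>x. \<bar>f x\<bar> powr 2 * norm x powr - (2 * a + 1)) H"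
      "(\<integral>x. norm (H x) \<partial>lborel) \<le> (2 + \<bar>2 * a + 1\<bar> * k) * (sqrt ?E * sqrt (wLp (a + 1) 2 f))"
      using C1c_on_weighted_power_grad_le[OF f a, of 2 "a + 1" "2 * a + 1"] by (auto simp: k_def)
    note H(2)
    also have "\<dots> \<le> (2 + \<bar>2 * a + 1\<bar> * k) * (sqrt ?E * (k * sqrt ?E))"
      using Hardy[OF f a] k energy_nonneg[of a G] by (intro mult_left_mono) (auto simp: k_def)
    also have "\<dots> = K * ?E"
      using energy_nonneg[of a G] by (simp add: K_def)
    finally have bound: "\<bar>f x\<bar> powr 2 * norm x powr - (2 * a + 1) \<le> K * ?E" for x
      using C1c_on_abs_le_integral_norm_grad_dim_1[OF H(1) d, of x] by simp
    have "wLp b p f \<le> (K * ?E) powr ((p - 2) / 2) * wLp (a + 1) 2 f"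
      by (rule wLp_le_if_bounded[OF C1c_on_wLp_integrable[OF f] bound])
        (use p b d in \<open>simp_all add: CKN_scaling_def field_simps\<close>)
    also have "\<dots> \<le> (K * ?E) powr ((p - 2) / 2) * (k\<^sup>2 * ?E powr 1)"
      using CKN_bound_Hardy[OF a] f by (intro mult_left_mono) (auto simp: CKN_bound_def k_def)
    also have "\<dots> = K powr ((p - 2) / 2) * k\<^sup>2 * ?E powr ((p - 2) / 2 + 1)"
      by (simp only: powr_mult powr_add mult_ac)
    also have "(p - 2) / 2 + 1 = p / 2"
      by (simp add: field_simps)
    finally show ?thesis .
  qed
  then show ?thesis
    unfolding CKN_bound_def by blast
qed

theorem Caffarelli_Kohn_Nirenberg:
  assumes adm: "admissible DIM('a::euclidean_space) a b p"
  shows "\<exists>C. CKN_bound TYPE('a) a b p C"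
proof -
  have a: "2 * a + 2 < real DIM('a)" and p: "2 \<le> p"
    and b: "CKN_scaling TYPE('a) a b p"
    using adm by (auto simp: admissible_def Let_def CKN_scaling_def field_simps)
  show ?thesis
  proof (cases "DIM('a) = 1")
    case True
    then show ?thesis by (rule CKN_bound_dim_1[OF a _ p b])
  next
    case False
    then have d: "2 \<le> DIM('a)"
      using DIM_positive[where 'a='a] by linarith
    moreover have "(real DIM('a) - 2) * p \<le> 2 * real DIM('a)"
      using adm d by (cases "DIM('a) = 2") (auto simp: admissible_def pos_le_divide_eq mult.commute)
    ultimately show ?thesis
      by (rule CKN_bound_dim_ge_2[OF a _ p _ b])
  qed
qed

subsection \<open>Vector fields of finite weighted energy\<close>

definition finite_energy :: "real \<Rightarrow> ('a::euclidean_space \<Rightarrow> 'a) \<Rightarrow> bool" where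
  "finite_energy a G \<longleftrightarrow> G \<in> borel_measurable borel \<and>
     integrable lborel (\<lambda>x. (norm (G x))\<^sup>2 * norm x powr (-2*a))"

definition weighted_inner :: "real \<Rightarrow> ('a::euclidean_space \<Rightarrow> 'b::real_inner) \<Rightarrow> ('a \<Rightarrow> 'b) \<Rightarrow> real" where
  "weighted_inner a F G = (\<integral>x. (F x \<bullet> G x) * norm x powr (-2*a) \<partial>lborel)"

lemma energy_eq_weighted_inner: "energy a G = weighted_inner a G G"
  by (simp add: energy_def weighted_inner_def power2_norm_eq_inner)

lemma C1c_on_finite_energy:
  assumes f: "C1c_on (- {0}) f G"
  shows "finite_energy a G"
  unfolding finite_energy_def
  by (auto intro!: C1c_on_measurable[OF f] C1c_on_integrable_norm_powr[OF f]
      continuous_intros C1c_on_continuous[OF f])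

lemma weighted_inner_Cauchy_Schwarz:
  assumes F: "finite_energy a F" and G: "finite_energy a G"
  shows weighted_inner_integrable: "integrable lborel (\<lambda>x. (F x \<bullet> G x) * norm x powr (-2*a))"
    and weighted_inner_le: "\<bar>weighted_inner a F G\<bar> \<le> sqrt (energy a F) * sqrt (energy a G)"
proof -
  have [measurable]: "F \<in> borel_measurable borel" "G \<in> borel_measurable borel"
    and int: "integrable lborel (\<lambda>x. (norm (F x))\<^sup>2 * norm x powr (-2*a))"
      "integrable lborel (\<lambda>x. (norm (G x))\<^sup>2 * norm x powr (-2*a))"
    using assms by (auto simp: finite_energy_def)
  have le: "\<bar>(F x \<bullet> G x) * norm x powr (-2*a)\<bar>
      \<le> ((norm (F x))\<^sup>2 * norm x powr (-2*a)) powr (1/2)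
        * ((norm (G x))\<^sup>2 * norm x powr (-2*a)) powr (1 - 1/2)" for x
  proof -
    have "\<bar>(F x \<bullet> G x) * norm x powr (-2*a)\<bar> \<le> norm (F x) * norm (G x) * norm x powr (-2*a)"
      by (simp add: abs_mult mult_right_mono Cauchy_Schwarz_ineq2)
    then show ?thesis
      by (simp add: powr_half_sqrt real_sqrt_mult mult_ac)
  qed
  show "integrable lborel (\<lambda>x. (F x \<bullet> G x) * norm x powr (-2*a))"
    by (rule integrable_if_le_Holder[OF int _ _ _ _ _ le]) auto
  show "\<bar>weighted_inner a F G\<bar> \<le> sqrt (energy a F) * sqrt (energy a G)"
    using abs_integral_le_Holder[OF int _ _ _ _ _ le]
    by (simp add: weighted_inner_def energy_def powr_half_sqrt)
qed

lemma
  assumes F: "finite_energy a F" and G: "finite_energy a G"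
  shows finite_energy_diff: "finite_energy a (\<lambda>x. F x - G x)"
    and energy_diff: "energy a (\<lambda>x. F x - G x) = energy a F - 2 * weighted_inner a G F + energy a G"
proof -
  have [measurable]: "F \<in> borel_measurable borel" "G \<in> borel_measurable borel"
    and int: "integrable lborel (\<lambda>x. (norm (F x))\<^sup>2 * norm x powr (-2*a))"
      "integrable lborel (\<lambda>x. (norm (G x))\<^sup>2 * norm x powr (-2*a))"
    using assms by (auto simp: finite_energy_def)
  note inner_int = weighted_inner_integrable[OF G F]
  have expand: "(norm (F x - G x))\<^sup>2 * norm x powr (-2*a) = (norm (F x))\<^sup>2 * norm x powr (-2*a)
      - 2 * ((G x \<bullet> F x) * norm x powr (-2*a)) + (norm (G x))\<^sup>2 * norm x powr (-2*a)" for x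
    by (simp add: power2_norm_eq_inner inner_diff inner_commute[of "F x" "G x"] algebra_simps)
  show "finite_energy a (\<lambda>x. F x - G x)"
    using int inner_int unfolding finite_energy_def expand by simp
  show "energy a (\<lambda>x. F x - G x) = energy a F - 2 * weighted_inner a G F + energy a G"
    using int inner_int unfolding energy_def weighted_inner_def expand by simp
qed

lemma weighted_inner_le_mean:
  assumes F: "finite_energy a F" and G: "finite_energy a G" and C: "0 < C"
  shows "weighted_inner a F G \<le> (C * energy a G + energy a F / C) / 2"
proof -
  have "weighted_inner a F G \<le> sqrt (energy a F) * sqrt (energy a G)"
    using weighted_inner_le[OF F G] by simp
  also have "\<dots> = sqrt (C * energy a G * (energy a F / C))"
    using C by (simp add: real_sqrt_mult)
  also have "\<dots> \<le> (C * energy a G + energy a F / C) / 2"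
    using C by (intro arith_geo_mean_sqrt) (auto simp: energy_nonneg)
  finally show ?thesis .
qed

lemma tendsto_weighted_inner:
  assumes F: "finite_energy a F" and G: "\<And>k. finite_energy a (G k)" "finite_energy a H"
    and lim: "(\<lambda>k. energy a (\<lambda>x. G k x - H x)) \<longlonglongrightarrow> 0"
  shows "(\<lambda>k. weighted_inner a F (G k)) \<longlonglongrightarrow> weighted_inner a F H"
proof (rule LIM_zero_cancel, rule Lim_null_comparison)
  have "weighted_inner a F (\<lambda>x. G k x - H x) = weighted_inner a F (G k) - weighted_inner a F H" for k
    using weighted_inner_integrable[OF F G(1)] weighted_inner_integrable[OF F G(2)]
    by (simp add: weighted_inner_def inner_diff_right left_diff_distrib)
  then show "\<forall>\<^sub>F k in sequentially. norm (weighted_inner a F (G k) - weighted_inner a F H)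
      \<le> sqrt (energy a F) * sqrt (energy a (\<lambda>x. G k x - H x))"
    using weighted_inner_le[OF F finite_energy_diff[OF G]] by (simp add: always_eventually)
  have "(\<lambda>k. sqrt (energy a F) * sqrt (energy a (\<lambda>x. G k x - H x))) \<longlonglongrightarrow> sqrt (energy a F) * sqrt 0"
    by (intro tendsto_intros lim)
  then show "(\<lambda>k. sqrt (energy a F) * sqrt (energy a (\<lambda>x. G k x - H x))) \<longlonglongrightarrow> 0"
    by simp
qed

lemma tendsto_energy:
  assumes G: "\<And>k. finite_energy a (G k)" "finite_energy a H"
    and lim: "(\<lambda>k. energy a (\<lambda>x. G k x - H x)) \<longlonglongrightarrow> 0"
  shows "(\<lambda>k. energy a (G k)) \<longlonglongrightarrow> energy a H"
proof -
  have "energy a (G k) = energy a (\<lambda>x. G k x - H x) + 2 * weighted_inner a H (G k) - energy a H" for k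
    using energy_diff[OF G, of k] by simp
  moreover have "(\<lambda>k. energy a (\<lambda>x. G k x - H x) + 2 * weighted_inner a H (G k) - energy a H)
      \<longlonglongrightarrow> 0 + 2 * weighted_inner a H H - energy a H"
    by (intro tendsto_intros lim tendsto_weighted_inner[OF G(2) G lim])
  ultimately show ?thesis
    by (simp add: energy_eq_weighted_inner)
qed

subsection \<open>Passage to the limit\<close>

lemma wLp_limit:
  fixes u :: "'a::euclidean_space \<Rightarrow> real"
  assumes p: "0 < p" and [measurable]: "u \<in> borel_measurable borel" and F: "\<And>j. wLp_integrable b p (F j)"
    and lim: "AE x in lborel. (\<lambda>j. F j x) \<longlonglongrightarrow> u x"
    and e: "\<And>j. wLp b p (F j) \<le> e j" "e \<longlonglongrightarrow> l"
  shows wLp_integrable_limit: "wLp_integrable b p u" and wLp_limit_le: "wLp b p u \<le> l"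
proof -
  let ?w = "\<lambda>x::'a. norm x powr (-b*p)"
  have [measurable]: "F j \<in> borel_measurable borel" for j
    using F by (simp add: wLp_integrable_def)
  have "0 \<le> e j" for j
    using order_trans[OF wLp_nonneg e(1)] .
  then have l: "0 \<le> l"
    using e(2) LIMSEQ_le_const by blast
  have "(\<integral>\<^sup>+x. ennreal (\<bar>u x\<bar> powr p * ?w x) \<partial>lborel)
      = (\<integral>\<^sup>+x. liminf (\<lambda>j. ennreal (\<bar>F j x\<bar> powr p * ?w x)) \<partial>lborel)"
  proof (rule nn_integral_cong_AE, use lim in eventually_elim)
    fix x assume "(\<lambda>j. F j x) \<longlonglongrightarrow> u x"
    then have "(\<lambda>j. ennreal (\<bar>F j x\<bar> powr p * ?w x)) \<longlonglongrightarrow> ennreal (\<bar>u x\<bar> powr p * ?w x)"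
      using p by (intro tendsto_ennrealI tendsto_mult tendsto_powr' tendsto_rabs tendsto_const) auto
    then show "ennreal (\<bar>u x\<bar> powr p * ?w x) = liminf (\<lambda>j. ennreal (\<bar>F j x\<bar> powr p * ?w x))"
      by (rule lim_imp_Liminf[OF sequentially_bot, symmetric])
  qed
  also have "\<dots> \<le> liminf (\<lambda>j. \<integral>\<^sup>+x. ennreal (\<bar>F j x\<bar> powr p * ?w x) \<partial>lborel)"
    by (rule nn_integral_liminf) measurable
  also have "\<dots> \<le> liminf (\<lambda>j. ennreal (e j))"
  proof (intro Liminf_mono always_eventually allI)
    fix j
    have "(\<integral>\<^sup>+x. ennreal (\<bar>F j x\<bar> powr p * ?w x) \<partial>lborel) = ennreal (wLp b p (F j))"
      using F[of j] by (simp add: wLp_integrable_def wLp_def nn_integral_eq_integral)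
    also have "\<dots> \<le> ennreal (e j)"
      by (intro ennreal_leI e(1))
    finally show "(\<integral>\<^sup>+x. ennreal (\<bar>F j x\<bar> powr p * ?w x) \<partial>lborel) \<le> ennreal (e j)" .
  qed
  also have "\<dots> = ennreal l"
    by (intro lim_imp_Liminf tendsto_ennrealI e(2)) simp
  finally have le: "(\<integral>\<^sup>+x. ennreal (\<bar>u x\<bar> powr p * ?w x) \<partial>lborel) \<le> ennreal l" .
  have int: "integrable lborel (\<lambda>x. \<bar>u x\<bar> powr p * ?w x)"
    by (rule integrableI_nonneg) (use le in \<open>auto intro: le_less_trans\<close>)
  then show "wLp_integrable b p u"
    by (simp add: wLp_integrable_def)
  show "wLp b p u \<le> l"
    using le l int by (simp add: wLp_def nn_integral_eq_integral ennreal_le_iff)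
qed

lemma CKN_bound_limit:
  fixes u :: "'a::euclidean_space \<Rightarrow> real"
  assumes C: "CKN_bound TYPE('a) a b p C" and p: "0 < p" and u: "u \<in> borel_measurable borel"
    and F: "\<And>j. C1c_on (- {0}) (F j) (G j)" "AE x in lborel. (\<lambda>j. F j x) \<longlonglongrightarrow> u x"
    and g: "finite_energy a g" "(\<lambda>j. energy a (\<lambda>x. G j x - g x)) \<longlonglongrightarrow> 0"
  shows "wLp_integrable b p u" and "wLp b p u \<le> C * energy a g powr (p / 2)"
proof -
  have "(\<lambda>j. energy a (G j)) \<longlonglongrightarrow> energy a g"
    by (rule tendsto_energy[OF C1c_on_finite_energy[OF F(1)] g])
  then have lim: "(\<lambda>j. C * energy a (G j) powr (p / 2)) \<longlonglongrightarrow> C * energy a g powr (p / 2)"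
    using p by (intro tendsto_intros tendsto_powr') (auto simp: energy_nonneg)
  have "wLp b p (F j) \<le> C * energy a (G j) powr (p / 2)" for j
    using C F(1) by (auto simp: CKN_bound_def)
  note limit = wLp_limit[OF p u C1c_on_wLp_integrable[OF F(1) p] F(2) this lim]
  show "wLp_integrable b p u" "wLp b p u \<le> C * energy a g powr (p / 2)"
    by (fact limit)+
qed

lemma D12_approximation:
  fixes u :: "'a::euclidean_space \<Rightarrow> real"
  assumes "D12 a u g"
  obtains \<phi> where "\<And>k. test_fun (\<phi> k)" "AE x in lborel. (\<lambda>k. \<phi> k x) \<longlonglongrightarrow> u x"
    "finite_energy a g" "(\<lambda>k. energy a (\<lambda>x. grad (\<phi> k) x - g x)) \<longlonglongrightarrow> 0"
proof -
  obtain \<phi> where test: "\<And>k. test_fun (\<phi> k)" and AE: "AE x in lborel. (\<lambda>k. \<phi> k x) \<longlonglongrightarrow> u x"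
    and lim: "(\<lambda>k. \<integral>\<^sup>+x. ennreal ((norm (grad (\<phi> k) x - g x))\<^sup>2 * norm x powr (-2*a)) \<partial>lborel) \<longlonglongrightarrow> 0"
    and [measurable]: "g \<in> borel_measurable borel"
    using assms by (auto simp: D12_def)
  have grad: "finite_energy a (grad (\<phi> k))" for k
    by (rule C1c_on_finite_energy[OF test_fun_C1c_on[OF test]])
  then have [measurable]: "grad (\<phi> k) \<in> borel_measurable borel" for k
    by (simp add: finite_energy_def)
  obtain k where "(\<integral>\<^sup>+x. ennreal ((norm (grad (\<phi> k) x - g x))\<^sup>2 * norm x powr (-2*a)) \<partial>lborel) < 1"
    using order_tendstoD(2)[OF lim, of 1] by (auto simp: eventually_sequentially)
  then have "finite_energy a (\<lambda>x. grad (\<phi> k) x - g x)"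
    unfolding finite_energy_def by (auto intro!: integrableI_nonneg elim: less_trans)
  from finite_energy_diff[OF grad[of k] this] have g: "finite_energy a g"
    by simp
  have "(\<integral>\<^sup>+x. ennreal ((norm (grad (\<phi> k) x - g x))\<^sup>2 * norm x powr (-2*a)) \<partial>lborel)
      = ennreal (energy a (\<lambda>x. grad (\<phi> k) x - g x))" for k
    unfolding energy_def using finite_energy_diff[OF grad g]
    by (intro nn_integral_eq_integral) (auto simp: finite_energy_def)
  with lim have "(\<lambda>k. ennreal (energy a (\<lambda>x. grad (\<phi> k) x - g x))) \<longlonglongrightarrow> ennreal 0"
    by simp
  then have "(\<lambda>k. energy a (\<lambda>x. grad (\<phi> k) x - g x)) \<longlonglongrightarrow> 0"
    by (subst (asm) tendsto_ennreal_iff) (auto simp: energy_nonneg)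
  with test AE g show ?thesis by (rule that)
qed

lemma D12_finite_energy: "D12 a u g \<Longrightarrow> finite_energy a g"
  by (erule D12_approximation)

lemma D12_CKN_bound:
  fixes u :: "'a::euclidean_space \<Rightarrow> real"
  assumes C: "CKN_bound TYPE('a) a b p C" and p: "0 < p" and u: "D12 a u g"
  shows D12_wLp_integrable: "wLp_integrable b p u"
    and D12_wLp_le: "wLp b p u \<le> C * energy a g powr (p / 2)"
proof -
  obtain \<phi> where \<phi>: "\<And>k. test_fun (\<phi> k)" "AE x in lborel. (\<lambda>k. \<phi> k x) \<longlonglongrightarrow> u x"
    "finite_energy a g" "(\<lambda>k. energy a (\<lambda>x. grad (\<phi> k) x - g x)) \<longlonglongrightarrow> 0"
    by (rule D12_approximation[OF u]) blast
  have "u \<in> borel_measurable borel"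
    using u by (simp add: D12_def)
  note limit = CKN_bound_limit[OF C p this test_fun_C1c_on[OF \<phi>(1)] \<phi>(2-4)]
  show "wLp_integrable b p u" "wLp b p u \<le> C * energy a g powr (p / 2)"
    by (fact limit)+
qed

lemma D12_approximation_wLp:
  fixes u :: "'a::euclidean_space \<Rightarrow> real"
  assumes C: "CKN_bound TYPE('a) a b p C" and p: "0 < p" and u: "D12 a u g"
  obtains \<phi> where "\<And>k. test_fun (\<phi> k)" "(\<lambda>k. energy a (\<lambda>x. grad (\<phi> k) x - g x)) \<longlonglongrightarrow> 0"
    "(\<lambda>k. wLp b p (\<lambda>x. \<phi> k x - u x)) \<longlonglongrightarrow> 0"
    "\<And>k. wLp_integrable b p (\<lambda>x. \<phi> k x - u x)"
proof -
  obtain \<phi> where test: "\<And>k. test_fun (\<phi> k)" and AE: "AE x in lborel. (\<lambda>k. \<phi> k x) \<longlonglongrightarrow> u x"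
    and g: "finite_energy a g" and lim: "(\<lambda>k. energy a (\<lambda>x. grad (\<phi> k) x - g x)) \<longlonglongrightarrow> 0"
    by (rule D12_approximation[OF u]) blast
  note C1c = test_fun_C1c_on[OF test]
  note diff_finite = finite_energy_diff[OF C1c_on_finite_energy[OF C1c] g]
  have [measurable]: "u \<in> borel_measurable borel" "\<phi> k \<in> borel_measurable borel" for k
    using u C1c_on_measurable[OF C1c] by (auto simp: D12_def)
  have diff: "wLp_integrable b p (\<lambda>x. \<phi> k x - u x)"
    "wLp b p (\<lambda>x. \<phi> k x - u x) \<le> C * energy a (\<lambda>x. grad (\<phi> k) x - g x) powr (p / 2)" for k
  proof -
    have AE': "AE x in lborel. (\<lambda>j. \<phi> k x - \<phi> j x) \<longlonglongrightarrow> \<phi> k x - u x"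
      using AE by eventually_elim (intro tendsto_intros)
    have "energy a (\<lambda>x. (grad (\<phi> k) x - grad (\<phi> j) x) - (grad (\<phi> k) x - g x))
        = energy a (\<lambda>x. grad (\<phi> j) x - g x)" for j
      by (simp add: energy_def norm_minus_commute)
    with lim have lim': "(\<lambda>j. energy a (\<lambda>x. (grad (\<phi> k) x - grad (\<phi> j) x) - (grad (\<phi> k) x - g x))) \<longlonglongrightarrow> 0"
      by simp
    show "wLp_integrable b p (\<lambda>x. \<phi> k x - u x)"
      "wLp b p (\<lambda>x. \<phi> k x - u x) \<le> C * energy a (\<lambda>x. grad (\<phi> k) x - g x) powr (p / 2)"
      by (rule CKN_bound_limit[OF C p _ C1c_on_diff[OF C1c C1c] AE' diff_finite lim']; measurable)+
  qed
  have "(\<lambda>k. C * energy a (\<lambda>x. grad (\<phi> k) x - g x) powr (p / 2)) \<longlonglongrightarrow> C * 0 powr (p / 2)"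
    using p lim by (intro tendsto_intros tendsto_powr') (auto simp: energy_nonneg)
  then have "(\<lambda>k. C * energy a (\<lambda>x. grad (\<phi> k) x - g x) powr (p / 2)) \<longlonglongrightarrow> 0"
    by simp
  then have "(\<lambda>k. wLp b p (\<lambda>x. \<phi> k x - u x)) \<longlonglongrightarrow> 0"
    by (rule Lim_null_comparison[rotated]) (simp add: abs_of_nonneg[OF wLp_nonneg] diff(2))
  with test lim show ?thesis using diff(1) by (rule that)
qed

subsection \<open>The optimal constant\<close>

lemma admissible_imp_p_ge_2: "admissible d a b p \<Longrightarrow> 2 \<le> p"
  by (simp add: admissible_def Let_def)

lemma ex_CKN_constant:
  assumes adm: "admissible DIM('a::euclidean_space) a b p"
  shows "\<exists>C. \<forall>(u :: 'a \<Rightarrow> real) g. D12 a u g \<longrightarrow> wLp b p u powr (2/p) \<le> C * energy a g"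
proof -
  have p: "0 < p" using admissible_imp_p_ge_2[OF adm] by simp
  obtain C where C: "CKN_bound TYPE('a) a b p C"
    using Caffarelli_Kohn_Nirenberg[OF adm] by blast
  have "wLp b p u powr (2/p) \<le> C powr (2/p) * energy a g" if u: "D12 a u g" for u :: "'a \<Rightarrow> real" and g
  proof -
    have "wLp b p u powr (2/p) \<le> (C * energy a g powr (p / 2)) powr (2/p)"
      using p D12_wLp_le[OF C p u] by (intro powr_mono2 wLp_nonneg) auto
    also have "\<dots> = C powr (2/p) * energy a g"
      using p by (simp add: powr_mult powr_powr energy_nonneg)
    finally show ?thesis .
  qed
  then show ?thesis by blast
qed

theorem CKN_const_bound:
  fixes u :: "'a::euclidean_space \<Rightarrow> real"
  assumes adm: "admissible DIM('a) a b p" and u: "D12 a u g"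
  shows "wLp b p u powr (2/p) \<le> CKN_const TYPE('a) a b p * energy a g"
proof -
  define S where "S = {C. \<forall>(u :: 'a \<Rightarrow> real) g. D12 a u g \<longrightarrow> wLp b p u powr (2/p) \<le> C * energy a g}"
  have "S \<noteq> {}"
    using ex_CKN_constant[OF adm] by (simp add: S_def)
  have le: "wLp b p u powr (2/p) \<le> C * energy a g" if "C \<in> S" for C
    using that u by (simp add: S_def)
  show ?thesis
  proof (cases "energy a g = 0")
    case True
    then show ?thesis using \<open>S \<noteq> {}\<close> le by auto
  next
    case False
    then have E: "0 < energy a g" using energy_nonneg[of a g] by simp
    then have "wLp b p u powr (2/p) / energy a g \<le> Inf S"
      using \<open>S \<noteq> {}\<close> le by (intro cInf_greatest) (auto simp: pos_divide_le_eq)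
    then show ?thesis
      using E by (simp add: CKN_const_def S_def pos_divide_le_eq)
  qed
qed

lemma wLp_pos:
  assumes u: "wLp_integrable b p u" and nonzero: "\<not> (AE x in lborel. u x = 0)"
  shows "0 < wLp b p u"
proof (rule ccontr)
  assume "\<not> 0 < wLp b p u"
  then have "wLp b p u = 0" using wLp_nonneg[of b p u] by linarith
  then have "AE x in lborel. \<bar>u x\<bar> powr p * norm x powr (-b*p) = 0"
    using u unfolding wLp_def wLp_integrable_def by (subst (asm) integral_nonneg_eq_0_iff_AE) auto
  moreover have "AE x in lborel. x \<noteq> 0"
    by (rule AE_lborel_singleton)
  ultimately have "AE x in lborel. u x = 0"
    by eventually_elim auto
  then show False using nonzero by contradiction
qed

lemma D12_wLp_pos:
  fixes u :: "'a::euclidean_space \<Rightarrow> real"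
  assumes adm: "admissible DIM('a) a b p" and u: "D12 a u g" and nonzero: "\<not> (AE x in lborel. u x = 0)"
  shows "0 < wLp b p u"
proof -
  have "0 < p" using admissible_imp_p_ge_2[OF adm] by simp
  then show ?thesis
    using Caffarelli_Kohn_Nirenberg[OF adm] D12_wLp_integrable[OF _ _ u] wLp_pos nonzero by blast
qed

lemma CKN_const_pos:
  fixes u :: "'a::euclidean_space \<Rightarrow> real"
  assumes adm: "admissible DIM('a) a b p" and u: "D12 a u g" and pos: "0 < wLp b p u"
  shows "0 < CKN_const TYPE('a) a b p"
proof -
  have "0 < CKN_const TYPE('a) a b p * energy a g"
    using less_le_trans[OF _ CKN_const_bound[OF adm u]] pos by simp
  then show ?thesis
    using energy_nonneg[of a g] by (simp add: zero_less_mult_iff)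
qed

subsection \<open>Duality\<close>

lemma weighted_inner_Holder:
  fixes v z :: "'a::euclidean_space \<Rightarrow> real"
  assumes p: "1 < p" and q: "q = p / (p - 1)"
    and v: "wLp_integrable (2*a - b) q v" and z: "wLp_integrable b p z"
  shows weighted_inner_integrable_wLp: "integrable lborel (\<lambda>x. (v x \<bullet> z x) * norm x powr (-2*a))"
    and weighted_inner_le_wLp: "\<bar>weighted_inner a v z\<bar> \<le> wLp (2*a - b) q v powr (1/q) * wLp b p z powr (1/p)"
proof -
  have [measurable]: "v \<in> borel_measurable borel" "z \<in> borel_measurable borel"
    and int: "integrable lborel (\<lambda>x. \<bar>v x\<bar> powr q * norm x powr (-(2*a - b)*q))"
      "integrable lborel (\<lambda>x. \<bar>z x\<bar> powr p * norm x powr (-b*p))"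
    using v z by (auto simp: wLp_integrable_def)
  have conjugate: "0 \<le> 1/q" "1/q \<le> 1" "1 - 1/q = 1/p" "q \<noteq> 0" "p \<noteq> 0"
    using p by (auto simp: q field_simps)
  have split: "\<bar>(v x \<bullet> z x) * norm x powr (-2*a)\<bar>
      = (\<bar>v x\<bar> powr q * norm x powr (-(2*a - b)*q)) powr (1/q)
        * (\<bar>z x\<bar> powr p * norm x powr (-b*p)) powr (1 - 1/q)" for x
  proof -
    have "norm x powr (-(2*a - b)) * norm x powr (-b) = norm x powr (-2*a)"
      unfolding powr_add[symmetric] by simp
    then show ?thesis
      unfolding conjugate(3) using conjugate(4,5) by (simp add: powr_mult powr_powr abs_mult mult_ac)
  qed
  show "integrable lborel (\<lambda>x. (v x \<bullet> z x) * norm x powr (-2*a))"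
    by (rule integrable_if_le_Holder[OF int _ _ conjugate(1,2) _ eq_refl[OF split]]) auto
  show "\<bar>weighted_inner a v z\<bar> \<le> wLp (2*a - b) q v powr (1/q) * wLp b p z powr (1/p)"
    using abs_integral_le_Holder[OF int _ _ conjugate(1,2) _ eq_refl[OF split]]
    unfolding conjugate(3) wLp_def weighted_inner_def by simp
qed

lemma tendsto_weighted_inner_wLp:
  fixes v z :: "'a::euclidean_space \<Rightarrow> real"
  assumes p: "1 < p" and q: "q = p / (p - 1)"
    and v: "wLp_integrable (2*a - b) q v" and z: "wLp_integrable b p z"
    and diff: "\<And>k. wLp_integrable b p (\<lambda>x. \<phi> k x - z x)"
    and lim: "(\<lambda>k. wLp b p (\<lambda>x. \<phi> k x - z x)) \<longlonglongrightarrow> 0"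
  shows "(\<lambda>k. weighted_inner a v (\<phi> k)) \<longlonglongrightarrow> weighted_inner a v z"
proof (rule LIM_zero_cancel, rule Lim_null_comparison)
  let ?V = "wLp (2*a - b) q v powr (1/q)"
  have "weighted_inner a v (\<phi> k) - weighted_inner a v z = weighted_inner a v (\<lambda>x. \<phi> k x - z x)" for k
  proof -
    have "weighted_inner a v (\<phi> k)
        = (\<integral>x. (v x \<bullet> (\<phi> k x - z x)) * norm x powr (-2*a) + (v x \<bullet> z x) * norm x powr (-2*a) \<partial>lborel)"
      by (simp add: weighted_inner_def algebra_simps)
    then show ?thesis
      using weighted_inner_integrable_wLp[OF p q v diff[of k]] weighted_inner_integrable_wLp[OF p q v z]
      by (simp add: weighted_inner_def)
  qed
  then show "\<forall>\<^sub>F k in sequentially. norm (weighted_inner a v (\<phi> k) - weighted_inner a v z)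
      \<le> ?V * wLp b p (\<lambda>x. \<phi> k x - z x) powr (1/p)"
    using weighted_inner_le_wLp[OF p q v diff] by (simp add: always_eventually)
  have "(\<lambda>k. ?V * wLp b p (\<lambda>x. \<phi> k x - z x) powr (1/p)) \<longlonglongrightarrow> ?V * 0 powr (1/p)"
    using p lim by (intro tendsto_intros tendsto_powr') (auto simp: wLp_nonneg)
  then show "(\<lambda>k. ?V * wLp b p (\<lambda>x. \<phi> k x - z x) powr (1/p)) \<longlonglongrightarrow> 0"
    by simp
qed

theorem La_weak_D12:
  fixes v w z :: "'a::euclidean_space \<Rightarrow> real"
  assumes adm: "admissible DIM('a) a b p" and q: "q = p / (p - 1)"
    and v: "wLp_integrable (2*a - b) q v" and w: "La_weak a w gw v" "finite_energy a gw" and z: "D12 a z gz"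
  shows "weighted_inner a v z = weighted_inner a gw gz"
proof -
  have p: "0 < p" "1 < p" using admissible_imp_p_ge_2[OF adm] by simp_all
  obtain C where C: "CKN_bound TYPE('a) a b p C"
    using Caffarelli_Kohn_Nirenberg[OF adm] by blast
  obtain \<phi> where test: "\<And>k. test_fun (\<phi> k)" and grad: "(\<lambda>k. energy a (\<lambda>x. grad (\<phi> k) x - gz x)) \<longlonglongrightarrow> 0"
    and lim: "(\<lambda>k. wLp b p (\<lambda>x. \<phi> k x - z x)) \<longlonglongrightarrow> 0"
    and diff: "\<And>k. wLp_integrable b p (\<lambda>x. \<phi> k x - z x)"
    by (rule D12_approximation_wLp[OF C p(1) z]) blast
  have "weighted_inner a v (\<phi> k) = weighted_inner a gw (grad (\<phi> k))" for k
    using w(1) test by (simp add: La_weak_def weighted_inner_def)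
  moreover have "(\<lambda>k. weighted_inner a v (\<phi> k)) \<longlonglongrightarrow> weighted_inner a v z"
    by (rule tendsto_weighted_inner_wLp[OF p(2) q v D12_wLp_integrable[OF C p(1) z] diff lim])
  moreover have "(\<lambda>k. weighted_inner a gw (grad (\<phi> k))) \<longlonglongrightarrow> weighted_inner a gw gz"
    by (rule tendsto_weighted_inner[OF w(2) C1c_on_finite_energy[OF test_fun_C1c_on[OF test]]
          D12_finite_energy[OF z] grad])
  ultimately show ?thesis
    using LIMSEQ_unique by auto
qed

corollary weighted_inner_La_inverse:
  fixes v w :: "'a::euclidean_space \<Rightarrow> real"
  assumes adm: "admissible DIM('a) a b p" and q: "q = p / (p - 1)"
    and v: "wLp_integrable (2*a - b) q v" and w: "D12 a w gw" "La_weak a w gw v"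
  shows "weighted_inner a v w = energy a gw"
  using La_weak_D12[OF adm q v w(2) D12_finite_energy[OF w(1)] w(1)] by (simp add: energy_eq_weighted_inner)

theorem weighted_inner_La_inverse_le:
  fixes v w :: "'a::euclidean_space \<Rightarrow> real"
  assumes adm: "admissible DIM('a) a b p" and q: "q = p / (p - 1)" and C: "0 \<le> CKN_const TYPE('a) a b p"
    and v: "wLp_integrable (2*a - b) q v" and w: "D12 a w gw" "La_weak a w gw v"
  shows "weighted_inner a v w \<le> CKN_const TYPE('a) a b p * wLp (2*a - b) q v powr (2/q)"
proof -
  let ?C = "CKN_const TYPE('a) a b p" and ?V = "wLp (2*a - b) q v powr (2/q)" and ?I = "weighted_inner a v w"
  have p: "0 < p" "1 < p" using admissible_imp_p_ge_2[OF adm] by simp_all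
  have w_int: "wLp_integrable b p w"
    using Caffarelli_Kohn_Nirenberg[OF adm] D12_wLp_integrable[OF _ p(1) w(1)] by blast
  have energy: "?I = energy a gw"
    by (rule weighted_inner_La_inverse[OF adm q v w])
  have sqrt: "x powr (1/r) = sqrt (x powr (2/r))" for x r :: real
    by (simp add: powr_powr flip: powr_half_sqrt)
  have "?I \<le> sqrt ?V * sqrt (wLp b p w powr (2/p))"
    using weighted_inner_le_wLp[OF p(2) q v w_int] unfolding sqrt by simp
  also have "\<dots> \<le> sqrt ?V * sqrt (?C * ?I)"
    unfolding energy by (intro mult_left_mono real_sqrt_le_mono CKN_const_bound[OF adm w(1)]) simp
  also have "\<dots> = sqrt (?C * ?V) * sqrt ?I"
    by (simp add: real_sqrt_mult)
  finally have "sqrt ?I * sqrt ?I \<le> sqrt (?C * ?V) * sqrt ?I"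
    using energy energy_nonneg[of a gw] by simp
  then have "sqrt ?I \<le> sqrt (?C * ?V)"
    using C by (cases "0 < sqrt ?I") (auto simp only: mult_le_cancel_right_pos, auto intro: order_trans[of _ 0])
  then show ?thesis by simp
qed

definition CKN_dual :: "real \<Rightarrow> real \<Rightarrow> real \<Rightarrow> ('a::euclidean_space \<Rightarrow> real) \<Rightarrow> 'a \<Rightarrow> real" where
  "CKN_dual a b p u x = wLp b p u powr ((2 - p) / p) * norm x powr (2*a - b*p) * u x powr (p - 1)"

lemma borel_measurable_CKN_dual [measurable]:
  "u \<in> borel_measurable borel \<Longrightarrow> CKN_dual a b p u \<in> borel_measurable borel"
  unfolding CKN_dual_def[abs_def] by measurable

lemma wLp_CKN_dual:
  assumes p: "1 < p" and q: "q = p / (p - 1)" and [measurable]: "u \<in> borel_measurable borel"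
    and nonneg: "AE x in lborel. 0 \<le> u x" and pos: "0 < wLp b p u"
  shows "wLp (2*a - b) q (CKN_dual a b p u) powr (2/q) = wLp b p u powr (2/p)"
proof -
  let ?N = "wLp b p u"
  have conjugate: "(p - 1) * q = p" "q * (p - 1) = p" using p by (simp_all add: q)
  have "wLp (2*a - b) q (CKN_dual a b p u)
      = (\<integral>x. ?N powr ((2 - p) / p * q) * (\<bar>u x\<bar> powr p * norm x powr (-b*p)) \<partial>lborel)"
    unfolding wLp_def[of "2*a - b"]
  proof (rule integral_cong_AE)
    show "AE x in lborel. \<bar>CKN_dual a b p u x\<bar> powr q * norm x powr (-(2*a - b)*q)
        = ?N powr ((2 - p) / p * q) * (\<bar>u x\<bar> powr p * norm x powr (-b*p))"
      using nonneg
    proof eventually_elim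
      fix x assume "0 \<le> u x"
      have "norm x powr ((2*a - b*p) * q) * norm x powr (-(2*a - b)*q) = norm x powr (-b*((p - 1)*q))"
        unfolding powr_add[symmetric] by (rule arg_cong[where f = "(powr) (norm x)"]) (simp add: algebra_simps)
      then show "\<bar>CKN_dual a b p u x\<bar> powr q * norm x powr (-(2*a - b)*q)
          = ?N powr ((2 - p) / p * q) * (\<bar>u x\<bar> powr p * norm x powr (-b*p))"
        using \<open>0 \<le> u x\<close> unfolding conjugate
        by (simp add: CKN_dual_def abs_mult powr_mult powr_powr conjugate mult_ac)
    qed
  qed measurable
  also have "\<dots> = ?N powr ((2 - p) / p * q + 1)"
    using pos by (simp add: powr_add wLp_def)
  finally have "wLp (2*a - b) q (CKN_dual a b p u) powr (2/q) = ?N powr (((2 - p) / p * q + 1) * (2/q))"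
    by (simp add: powr_powr)
  also have "((2 - p) / p * q + 1) * (2/q) = 2/p"
    using p unfolding q by (simp add: field_simps)
  finally show ?thesis .
qed

lemma weighted_inner_CKN_dual:
  assumes p: "1 < p" and [measurable]: "u \<in> borel_measurable borel"
    and nonneg: "AE x in lborel. 0 \<le> u x" and pos: "0 < wLp b p u"
  shows "weighted_inner a (CKN_dual a b p u) u = wLp b p u powr (2/p)"
proof -
  let ?N = "wLp b p u"
  have "weighted_inner a (CKN_dual a b p u) u
      = (\<integral>x. ?N powr ((2 - p) / p) * (\<bar>u x\<bar> powr p * norm x powr (-b*p)) \<partial>lborel)"
    unfolding weighted_inner_def
  proof (rule integral_cong_AE)
    show "AE x in lborel. (CKN_dual a b p u x \<bullet> u x) * norm x powr (-2*a)
        = ?N powr ((2 - p) / p) * (\<bar>u x\<bar> powr p * norm x powr (-b*p))"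
      using nonneg
    proof eventually_elim
      fix x assume "0 \<le> u x"
      then have "u x * u x powr (p - 1) = \<bar>u x\<bar> powr p"
        by (simp add: powr_mult_base)
      moreover have "norm x powr (2*a - b*p) * norm x powr (-2*a) = norm x powr (-b*p)"
        unfolding powr_add[symmetric] by simp
      ultimately show "(CKN_dual a b p u x \<bullet> u x) * norm x powr (-2*a)
          = ?N powr ((2 - p) / p) * (\<bar>u x\<bar> powr p * norm x powr (-b*p))"
        by (simp add: CKN_dual_def mult_ac)
    qed
  qed measurable
  also have "\<dots> = ?N powr ((2 - p) / p + 1)"
    using pos by (simp add: powr_add wLp_def)
  also have "(2 - p) / p + 1 = 2/p"
    using p by (simp add: field_simps)
  finally show ?thesis .
qed

theorem mainTheorem9:
  fixes u w :: "'a::euclidean_space \<Rightarrow> real" and g gw :: "'a \<Rightarrow> 'a"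
    and a b p q \<kappa> :: real and v :: "'a \<Rightarrow> real"
  assumes adm: "admissible DIM('a) a b p"
    and q_def: "q = p / (p - 1)"
    and u_D: "D12 a u g"
    and u_nonneg: "AE x in lborel. u x \<ge> 0"
    and u_nonzero: "\<not> (AE x in lborel. u x = 0)"
    and kappa_def: "\<kappa> = wLp b p u powr (1/p)"
    and v_def: "v = (\<lambda>x. \<kappa> powr (2 - p) * norm x powr (2*a - b*p) * u x powr (p - 1))"
    and v_Lq: "v \<in> borel_measurable lborel"
              "integrable lborel (\<lambda>x. \<bar>v x\<bar> powr q * norm x powr (-(2*a - b)*q))"
    and w_D: "D12 a w gw"
    and w_inv: "La_weak a w gw v"
  shows "0 \<le> wLp (2*a - b) q v powr (2/q)
              - (1 / CKN_const TYPE('a) a b p) * (\<integral>x. v x * w x * norm x powr (-2*a) \<partial>lborel)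
       \<and> wLp (2*a - b) q v powr (2/q)
              - (1 / CKN_const TYPE('a) a b p) * (\<integral>x. v x * w x * norm x powr (-2*a) \<partial>lborel)
         \<le> CKN_const TYPE('a) a b p * energy a g - wLp b p u powr (2/p)"
proof -
  let ?C = "CKN_const TYPE('a) a b p" and ?M = "wLp b p u powr (2/p)"
  have p: "1 < p" using admissible_imp_p_ge_2[OF adm] by simp
  have u: "u \<in> borel_measurable borel" using u_D by (simp add: D12_def)
  have pos: "0 < wLp b p u" by (rule D12_wLp_pos[OF adm u_D u_nonzero])
  have C: "0 < ?C" by (rule CKN_const_pos[OF adm u_D pos])
  have v: "v = CKN_dual a b p u"
    unfolding v_def kappa_def CKN_dual_def by (simp add: powr_powr)
  have v_int: "wLp_integrable (2*a - b) q v"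
    using v_Lq by (simp add: wLp_integrable_def)
  have v_norm: "wLp (2*a - b) q v powr (2/q) = ?M"
    unfolding v by (rule wLp_CKN_dual[OF p q_def u u_nonneg pos])
  have energy: "weighted_inner a v w = energy a gw"
    by (rule weighted_inner_La_inverse[OF adm q_def v_int w_D w_inv])
  have lower: "energy a gw / ?C \<le> ?M"
    using weighted_inner_La_inverse_le[OF adm q_def less_imp_le[OF C] v_int w_D w_inv] C
    unfolding energy v_norm by (simp add: pos_divide_le_eq mult.commute)
  have "?M = weighted_inner a v u"
    unfolding v by (rule weighted_inner_CKN_dual[OF p u u_nonneg pos, symmetric])
  also have "\<dots> = weighted_inner a gw g"
    by (rule La_weak_D12[OF adm q_def v_int w_inv D12_finite_energy[OF w_D] u_D])
  also have "\<dots> \<le> (?C * energy a g + energy a gw / ?C) / 2"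
    by (rule weighted_inner_le_mean[OF D12_finite_energy[OF w_D] D12_finite_energy[OF u_D] C])
  finally show ?thesis
    using lower energy unfolding v_norm by (simp add: weighted_inner_def)
qed

end
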